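(* Suppose that, as $n\to\infty$, $W_n\to W$ in distribution for some random variable $W$, $\mathbf{E}[W_n]\to\mathbf{E}[W]\in(0,\infty)$ and $\mathbf{E}[W_n^2]\to\mathbf{E}[W^2]<\infty$. Let $Q_k^{(n)}=\frac1n\sum_{i\in[n]}\mathbf 1_{\{d_i=k\}}$, where $d_i$ is the degree of vertex $i$ in $\mathrm{DRIG}_n(\mathbf w)$. Then for every $\varepsilon>0$, $$\mathbf P\Big(\sum_{k=0}^\infty|Q_k^{(n)}-q_k|>\varepsilon\Big)\longrightarrow0,\qquad n\to\infty,$$ where $q_k=\mathbf P\big(\sum_{l\ge2}(l-1)X_l=k\big)$ and $(X_l)_{l\ge2}$ are independent mixed-Poisson variables with mixing distribution $lp_lW$, i.e. such that $\mathbf P(X_l=k)=\mathbf E\big[e^{-lp_lW}\frac{(lp_lW)^k}{k!}\big]$.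
   Context: Notation. $[n]=\{1,\dots,n\}$; $[n]_k$ is the set of $k$-element subsets of $[n]$; elements $a\in\bigcup_{k\ge 2}[n]_k$ are called groups and $|a|$ is the size of $a$. For each $n$, $\mathbf{w}=(w_i)_{i\in[n]}$ are deterministic nonnegative vertex weights (possibly depending on $n$), $\ell_n=\sum_{i\in[n]}w_i>0$, and $W_n=w_{o_n}$ is the weight of a uniformly chosen vertex $o_n\in[n]$. $(p_k)_{k\ge2}$ is a probability mass function with $\mu=\sum_{k\ge2}kp_k<\infty$ and $\mu_{(2)}=\sum_{k\ge2}k^2p_k<\infty$; $f(k)=k!\,p_k$. Static model. Independently over groups, group $a$ is ON with probability $\dfrac{f(|a|)\prod_{i\in a}w_i}{\ell_n^{|a|-1}+f(|a|)\prod_{i\in a}w_i}$ and OFF otherwise. $\mathrm{DRIG}_n(\mathbf{w})$ is the multigraph on $[n]$ in which the number of edges between $i\ne j$ is the number of ON groups containing both $i$ and $j$; thus $d_i=\sum_{k\ge2}\sum_{a\in[n]_k:\,a\ni i}(|a|-1)\mathbf 1\{a\text{ is ON}\}$.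
   Formalization: The variables X_l are taken to be conditionally independent given the single variable W, with X_l Poisson of parameter l p_l W given W; with unconditional independence the claim fails, e.g. for p_2=p_3=1/2 and weights 0 and 2 on half the vertices each. *)

theory Defs
  imports "HOL-Probability.Probability"
begin

definition groups :: "nat \<Rightarrow> nat set set" where
  "groups n = {a. a \<subseteq> {1..n} \<and> 2 \<le> card a}"

definition total_weight :: "nat \<Rightarrow> (nat \<Rightarrow> real) \<Rightarrow> real" where
  "total_weight n w = (\<Sum>i\<in>{1..n}. w i)"

definition group_factor :: "nat pmf \<Rightarrow> nat \<Rightarrow> real" where
  "group_factor p k = fact k * pmf p k"

definition on_prob :: "nat pmf \<Rightarrow> nat \<Rightarrow> (nat \<Rightarrow> real) \<Rightarrow> nat set \<Rightarrow> real" where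
  "on_prob p n w a =
     group_factor p (card a) * (\<Prod>i\<in>a. w i) /
       (total_weight n w ^ (card a - 1) + group_factor p (card a) * (\<Prod>i\<in>a. w i))"

text \<open>An outcome \<open>\<omega>\<close> maps each group to its status (\<open>True\<close> is ON). Sets that are not groups
  have the fixed status \<open>False\<close>.\<close>

definition group_pmf :: "nat pmf \<Rightarrow> nat \<Rightarrow> (nat \<Rightarrow> real) \<Rightarrow> (nat set \<Rightarrow> bool) pmf" where
  "group_pmf p n w = Pi_pmf (groups n) False (\<lambda>a. bernoulli_pmf (on_prob p n w a))"

definition edge_mult :: "nat \<Rightarrow> (nat set \<Rightarrow> bool) \<Rightarrow> nat \<Rightarrow> nat \<Rightarrow> nat" where
  "edge_mult n \<omega> i j = (if i = j then 0 else card {a \<in> groups n. \<omega> a \<and> i \<in> a \<and> j \<in> a})"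

definition degree :: "nat \<Rightarrow> (nat set \<Rightarrow> bool) \<Rightarrow> nat \<Rightarrow> nat" where
  "degree n \<omega> i = (\<Sum>j\<in>{1..n}. edge_mult n \<omega> i j)"

lemma finite_groups: "finite (groups n)"
  by (rule finite_subset[of _ "Pow {1..n}"]) (auto simp: groups_def)

lemma degree_eq_sum_groups:
  "degree n \<omega> i =
     (\<Sum>k\<in>{2..n}. \<Sum>a | a \<subseteq> {1..n} \<and> card a = k \<and> i \<in> a. (card a - 1) * (if \<omega> a then 1 else 0))"
proof -
  have "degree n \<omega> i = (\<Sum>j\<in>{1..n}. \<Sum>a\<in>groups n. if \<omega> a \<and> i \<in> a \<and> j \<in> a \<and> j \<noteq> i then 1 else 0)"
    unfolding degree_def edge_mult_def
    by (intro sum.cong refl) (auto simp: finite_groups sum.If_cases Int_def)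
  also have "\<dots> = (\<Sum>a\<in>groups n. \<Sum>j\<in>{1..n}. if \<omega> a \<and> i \<in> a \<and> j \<in> a \<and> j \<noteq> i then 1 else 0)"
    by (rule sum.swap)
  also have "\<dots> = (\<Sum>a\<in>groups n. if \<omega> a \<and> i \<in> a then card a - 1 else 0)"
  proof (intro sum.cong refl)
    fix a assume "a \<in> groups n"
    then have sub: "a \<subseteq> {1..n}" and fin: "finite a"
      by (auto simp: groups_def intro: finite_subset)
    have "{1..n} \<inter> {j. j \<in> a \<and> j \<noteq> i} = a - {i}"
      using sub by auto
    then show "(\<Sum>j\<in>{1..n}. if \<omega> a \<and> i \<in> a \<and> j \<in> a \<and> j \<noteq> i then 1 else 0)
        = (if \<omega> a \<and> i \<in> a then card a - 1 else 0)"
      using fin by (auto simp: sum.If_cases)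
  qed
  also have "\<dots> = (\<Sum>a | a \<in> groups n \<and> i \<in> a. (card a - 1) * (if \<omega> a then 1 else 0))"
    by (rule sum.mono_neutral_cong_right) (auto simp: finite_groups)
  also have "\<dots> = (\<Sum>k\<in>{2..n}. \<Sum>a | a \<in> {a. a \<in> groups n \<and> i \<in> a} \<and> card a = k.
      (card a - 1) * (if \<omega> a then 1 else 0))"
  proof (rule sum.group[symmetric])
    show "card ` {a. a \<in> groups n \<and> i \<in> a} \<subseteq> {2..n}"
      using card_mono[of "{1..n}"] by (fastforce simp: groups_def)
  qed (auto simp: finite_groups)
  also have "\<dots> = (\<Sum>k\<in>{2..n}. \<Sum>a | a \<subseteq> {1..n} \<and> card a = k \<and> i \<in> a.
      (card a - 1) * (if \<omega> a then 1 else 0))"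
    by (intro sum.cong refl) (auto simp: groups_def)
  finally show ?thesis .
qed

definition degree_prop :: "nat \<Rightarrow> (nat set \<Rightarrow> bool) \<Rightarrow> nat \<Rightarrow> real" where
  "degree_prop n \<omega> k = (\<Sum>i\<in>{1..n}. of_bool (degree n \<omega> i = k)) / real n"

text \<open>
  All the \<open>X l\<close> are mixed over the same random variable \<open>W\<close>: given \<open>W\<close>, they are independent and
  \<open>X l\<close> is Poisson with parameter \<open>l * pmf p l * W\<close>. They are in general not independent
  unconditionally; a family of unconditionally independent variables with the same marginals would
  give a different (wrong) limit, because the numbers of groups of the different sizes that contain
  a vertex are all driven by the weight of that vertex.
\<close>

definition mixed_poisson_family ::
    "'a measure \<Rightarrow> nat pmf \<Rightarrow> ('a \<Rightarrow> real) \<Rightarrow> (nat \<Rightarrow> 'a \<Rightarrow> nat) \<Rightarrow> bool" where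
  "mixed_poisson_family M p W X \<longleftrightarrow>
     (\<forall>l\<ge>2. X l \<in> measurable M (count_space UNIV)) \<and>
     (\<forall>L k. finite L \<and> L \<subseteq> {2..} \<longrightarrow>
        (AE \<omega> in M.
           real_cond_exp M (vimage_algebra (space M) W borel)
             (indicat_real {\<omega> \<in> space M. \<forall>l\<in>L. X l \<omega> = k l}) \<omega> =
           (\<Prod>l\<in>L. exp (- (real l * pmf p l * W \<omega>)) *
                    (real l * pmf p l * W \<omega>) ^ k l / fact (k l))))"

lemma mixed_poisson_family_marginal:
  assumes M: "prob_space M" and W: "W \<in> borel_measurable M"
    and X: "mixed_poisson_family M p W X" and l: "2 \<le> l"
  shows "measure M {\<omega> \<in> space M. X l \<omega> = k} =
    (\<integral>\<omega>. exp (- (real l * pmf p l * W \<omega>)) * (real l * pmf p l * W \<omega>) ^ k / fact k \<partial>M)"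
proof -
  interpret prob_space M by (rule M)
  let ?F = "vimage_algebra (space M) W borel"
  let ?A = "{\<omega> \<in> space M. X l \<omega> = k}"
  have "subalgebra M ?F"
    using W by (auto simp: subalgebra_def sets_vimage_algebra2 measurable_sets)
  then interpret finite_measure_subalgebra M ?F
    by unfold_locales
  have "X l \<in> measurable M (count_space UNIV)"
    using X l by (auto simp: mixed_poisson_family_def)
  then have A[measurable]: "?A \<in> sets M"
    by measurable
  have "AE \<omega> in M. real_cond_exp M ?F (indicat_real ?A) \<omega> =
      exp (- (real l * pmf p l * W \<omega>)) * (real l * pmf p l * W \<omega>) ^ k / fact k"
    using X l unfolding mixed_poisson_family_def
    by (auto dest!: conjunct2 spec[of _ "{l}"] spec[of _ "\<lambda>_. k"])
  then have "(\<integral>\<omega>. exp (- (real l * pmf p l * W \<omega>)) * (real l * pmf p l * W \<omega>) ^ k / fact k \<partial>M)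
      = (\<integral>\<omega>. real_cond_exp M ?F (indicat_real ?A) \<omega> \<partial>M)"
    by (intro integral_cong_AE) (use W in auto)
  also have "\<dots> = (\<integral>\<omega>. indicat_real ?A \<omega> \<partial>M)"
    by (intro real_cond_exp_int) (auto simp: integrable_indicator_iff A less_top[symmetric])
  also have "\<dots> = measure M ?A"
    using A by simp
  finally show ?thesis by simp
qed

text \<open>The sum is taken in \<^typ>\<open>ennreal\<close>, where it always exists.\<close>

definition limit_prob :: "'a measure \<Rightarrow> (nat \<Rightarrow> 'a \<Rightarrow> nat) \<Rightarrow> nat \<Rightarrow> real" where
  "limit_prob M X k =
     measure M {\<omega> \<in> space M. (\<Sum>\<^sub>\<infinity>l\<in>{2..}. of_nat ((l - 1) * X l \<omega>) :: ennreal) = of_nat k}"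

end

theory Submission
  imports Defs
begin

text \<open>The proof works with the generating function
  \<open>G n s = (\<Sum>k. degree_prop n \<omega> k * s ^ k) = (\<Sum>i\<in>{1..n}. s ^ degree n \<omega> i) / n\<close> of the empirical
  degree distribution. Groups are independent, so the expectation of \<open>s ^ degree n \<omega> i\<close> is a finite
  product over the groups that contain \<open>i\<close>.

  Mean. A group \<open>a\<close> is ON with probability \<open>r / (1 + r)\<close>, where \<open>r\<close> are its odds. The factor that \<open>a\<close>
  contributes differs from \<open>exp (- r * (1 - s ^ (card a - 1)))\<close> by at most \<open>min r (r\<^sup>2)\<close>. The odds of the
  groups of size \<open>l\<close> that contain \<open>i\<close> add up to at most \<open>l * pmf p l * w i\<close>, and this bound would be an
  equality if the vertices of a group were drawn with replacement. Because the deficit is never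
  negative, its size need only be found on average over \<open>i\<close>, where it is an elementary symmetric sum of
  the weights: for each \<open>l\<close> it is governed by the chance of a repeated vertex, which is of order
  \<open>(\<Sum>i. (w i)\<^sup>2) / (\<Sum>i. w i)\<^sup>2\<close> and hence of order \<open>1 / n\<close>. Tannery's theorem sums this over all \<open>l\<close>
  with the dominating series \<open>l * pmf p l\<close>. So the mean of \<open>G n s\<close> is close to the average of
  \<open>exp (- w i * c)\<close> over the vertices, with \<open>c = (\<Sum>l. l * pmf p l * (1 - s ^ (l - 1)))\<close>, and weak convergence
  of the weights gives the limit \<open>E (exp (- W * c))\<close>. This is the generating function of the limit law:
  given \<open>W\<close>, the sum of \<open>(l - 1) * X l\<close> is compound Poisson.

  Variance. The covariance of \<open>s ^ degree n \<omega> i\<close> and \<open>s ^ degree n \<omega> j\<close> comes only from groups that contain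
  both vertices and is at most the sum of their odds. The sum over all pairs is of order \<open>n\<close>, because
  \<open>(\<Sum>l. l\<^sup>2 * pmf p l)\<close> is finite, so the variance of \<open>G n s\<close> is of order \<open>1 / n\<close>.

  Conclusion. Both facts give \<open>L\<^sup>1\<close> convergence of \<open>G n s\<close> for each \<open>s\<close> strictly between 0 and 1.
  The coefficient of \<open>s ^ k\<close> is recovered from the generating function and the earlier coefficients up to
  an error \<open>s\<close>, so each \<open>degree_prop n \<omega> k\<close> converges in \<open>L\<^sup>1\<close> by induction on \<open>k\<close>. Both laws have total
  mass 1, so the argument of Scheffe turns this into \<open>L\<^sup>1\<close> convergence of the whole sum, and Markov's
  inequality finishes the proof. The lemmas that carry the argument are
  \<open>expectation_power_degree_approx\<close>, \<open>sum_odds_defect_le\<close>, \<open>variance_degree_transform\<close>,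
  \<open>limit_transform\<close>, \<open>coefficient_diff_le\<close> and \<open>l1_distance_le\<close>.\<close>

section \<open>Elementary symmetric sums\<close>

definition esym :: "'a set \<Rightarrow> ('a \<Rightarrow> real) \<Rightarrow> nat \<Rightarrow> real" where
  "esym V x l = (\<Sum>a | a \<subseteq> V \<and> card a = l. \<Prod>i\<in>a. x i)"

text \<open>Double counting: a set with a marked element is the same as a smaller set with a new element. All
  identities for elementary symmetric sums below are instances of this.\<close>

lemma sum_subsets_remove:
  fixes G :: "'a set \<Rightarrow> 'a \<Rightarrow> real"
  assumes V: "finite V"
  shows "(\<Sum>b | b \<subseteq> V \<and> card b = Suc l. \<Sum>j\<in>b. G (b - {j}) j) =
         (\<Sum>a | a \<subseteq> V \<and> card a = l. \<Sum>j\<in>V - a. G a j)"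
proof -
  have fin: "finite {b. b \<subseteq> V \<and> card b = m}" for m
    using V by (auto intro: finite_subset[of _ "Pow V"])
  have fin_sub: "b \<subseteq> V \<Longrightarrow> finite b" for b
    using V by (rule finite_subset[rotated])
  have "(\<Sum>b | b \<subseteq> V \<and> card b = Suc l. \<Sum>j\<in>b. G (b - {j}) j) =
        (\<Sum>(b, j)\<in>(SIGMA b:{b. b \<subseteq> V \<and> card b = Suc l}. b). G (b - {j}) j)"
    using fin fin_sub by (intro sum.Sigma) auto
  also have "\<dots> = (\<Sum>(a, j)\<in>(SIGMA a:{a. a \<subseteq> V \<and> card a = l}. V - a). G a j)"
    by (rule sum.reindex_bij_witness[of _ "\<lambda>(a, j). (insert j a, j)" "\<lambda>(b, j). (b - {j}, j)"])
      (auto simp: insert_absorb fin_sub)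
  also have "\<dots> = (\<Sum>a | a \<subseteq> V \<and> card a = l. \<Sum>j\<in>V - a. G a j)"
    using fin V by (intro sum.Sigma[symmetric]) auto
  finally show ?thesis .
qed

lemma esym_0 [simp]: "finite V \<Longrightarrow> esym V x 0 = 1"
proof -
  assume V: "finite V"
  have "{a. a \<subseteq> V \<and> card a = 0} = {{}}"
    using V by (auto dest: finite_subset)
  then show ?thesis by (simp add: esym_def)
qed

lemma esym_nonneg: "(\<And>i. i \<in> V \<Longrightarrow> 0 \<le> x i) \<Longrightarrow> 0 \<le> esym V x l"
  unfolding esym_def by (intro sum_nonneg prod_nonneg) auto

context
  fixes V :: "'a set" and x :: "'a \<Rightarrow> real"
  assumes V: "finite V" and x: "\<And>i. i \<in> V \<Longrightarrow> 0 \<le> x i"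
begin

lemma prod_remove_subset: "b \<subseteq> V \<Longrightarrow> j \<in> b \<Longrightarrow> prod x b = x j * prod x (b - {j})"
  using V by (intro prod.remove) (auto dest: finite_subset)

text \<open>Extending a set by a new element loses, against multiplication by the full sum, exactly the choices
  that repeat an element already present.\<close>

lemma esym_Suc: 
  "real (Suc l) * esym V x (Suc l) = 
     sum x V * esym V x l - (\<Sum>a | a \<subseteq> V \<and> card a = l. prod x a * sum x a)"
proof -
  have "real (Suc l) * esym V x (Suc l) =
      (\<Sum>b | b \<subseteq> V \<and> card b = Suc l. \<Sum>j\<in>b. x j * prod x (b - {j}))"
    unfolding esym_def sum_distrib_left
  proof (intro sum.cong refl)
    fix b assume b: "b \<in> {b. b \<subseteq> V \<and> card b = Suc l}"
    have "(\<Sum>j\<in>b. x j * prod x (b - {j})) = (\<Sum>j\<in>b. prod x b)"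
      using b by (intro sum.cong refl) (simp add: prod_remove_subset)
    then show "real (Suc l) * prod x b = (\<Sum>j\<in>b. x j * prod x (b - {j}))"
      using b by simp
  qed
  also have "\<dots> = (\<Sum>a | a \<subseteq> V \<and> card a = l. \<Sum>j\<in>V - a. x j * prod x a)"
    using sum_subsets_remove[OF V, where l = l and G = "\<lambda>a j. x j * prod x a"] by simp
  also have "\<dots> = (\<Sum>a | a \<subseteq> V \<and> card a = l. sum x V * prod x a - prod x a * sum x a)"
    using V by (intro sum.cong refl) (auto simp: sum_diff sum_distrib_right[symmetric] algebra_simps)
  finally show ?thesis
    by (simp add: sum_subtractf esym_def sum_distrib_left)
qed

text \<open>The loss in the preceding recursion: the repeated element contributes its square, and forgetting
  that the others avoid it only increases the sum.\<close>

lemma esym_collision_le: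
  "(\<Sum>b | b \<subseteq> V \<and> card b = Suc l. prod x b * sum x b) \<le> (\<Sum>i\<in>V. (x i)\<^sup>2) * esym V x l"
proof -
  have "(\<Sum>b | b \<subseteq> V \<and> card b = Suc l. prod x b * sum x b) =
      (\<Sum>b | b \<subseteq> V \<and> card b = Suc l. \<Sum>j\<in>b. (x j)\<^sup>2 * prod x (b - {j}))"
    unfolding sum_distrib_left
    by (intro sum.cong refl) (auto simp: prod_remove_subset power2_eq_square)
  also have "\<dots> = (\<Sum>a | a \<subseteq> V \<and> card a = l. \<Sum>j\<in>V - a. (x j)\<^sup>2 * prod x a)"
    using sum_subsets_remove[OF V, where l = l and G = "\<lambda>a j. (x j)\<^sup>2 * prod x a"] by simp
  also have "\<dots> \<le> (\<Sum>a | a \<subseteq> V \<and> card a = l. \<Sum>j\<in>V. (x j)\<^sup>2 * prod x a)"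
    using V x by (intro sum_mono sum_mono2) (auto intro!: mult_nonneg_nonneg prod_nonneg)
  also have "\<dots> = (\<Sum>i\<in>V. (x i)\<^sup>2) * esym V x l"
    by (simp add: esym_def sum_distrib_left[symmetric] sum_distrib_right[symmetric])
  finally show ?thesis .
qed

lemma fact_esym_Suc_le: "fact (Suc l) * esym V x (Suc l) \<le> sum x V * (fact l * esym V x l)"
proof -
  have "real (Suc l) * esym V x (Suc l) \<le> sum x V * esym V x l"
    unfolding esym_Suc using x
    by (auto intro!: sum_nonneg mult_nonneg_nonneg prod_nonneg)
  then have "fact l * (real (Suc l) * esym V x (Suc l)) \<le> fact l * (sum x V * esym V x l)"
    by (intro mult_left_mono) auto
  then show ?thesis
    by (simp add: algebra_simps)
qed

lemma fact_esym_le: "fact l * esym V x l \<le> sum x V ^ l"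
proof (induction l)
  case 0 then show ?case using V by simp
next
  case (Suc l)
  have "fact (Suc l) * esym V x (Suc l) \<le> sum x V * (fact l * esym V x l)"
    by (rule fact_esym_Suc_le)
  also have "\<dots> \<le> sum x V * sum x V ^ l"
    using x by (intro mult_left_mono Suc sum_nonneg) auto
  finally show ?case by simp
qed

text \<open>Divided by \<open>sum x V ^ (l + 2)\<close> this says that a sample of size \<open>l + 2\<close> drawn with replacement, with
  probabilities proportional to \<open>x\<close>, has a repetition with probability at most the expected number of
  coinciding pairs.\<close>

lemma fact_esym_ge:
  "sum x V ^ (l + 2) - real (l + 1) * real (l + 2) / 2 * (\<Sum>i\<in>V. (x i)\<^sup>2) * sum x V ^ l
     \<le> fact (l + 2) * esym V x (l + 2)"
proof -
  let ?L = "sum x V" and ?S = "\<Sum>i\<in>V. (x i)\<^sup>2"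
  have L: "0 \<le> ?L" and S: "0 \<le> ?S"
    using x by (auto intro: sum_nonneg)
  have step: "?L * (fact (Suc m) * esym V x (Suc m)) - real (Suc m) * ?S * ?L ^ m
      \<le> fact (Suc (Suc m)) * esym V x (Suc (Suc m))" for m
  proof -
    have "?L * esym V x (Suc m) - ?S * esym V x m \<le> real (Suc (Suc m)) * esym V x (Suc (Suc m))"
      unfolding esym_Suc[of "Suc m"] using esym_collision_le[of m] by simp
    then have "fact (Suc m) * (?L * esym V x (Suc m) - ?S * esym V x m)
        \<le> fact (Suc m) * (real (Suc (Suc m)) * esym V x (Suc (Suc m)))"
      by (intro mult_left_mono) auto
    then have "?L * (fact (Suc m) * esym V x (Suc m)) - real (Suc m) * ?S * (fact m * esym V x m)
        \<le> fact (Suc (Suc m)) * esym V x (Suc (Suc m))"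
      by (simp add: algebra_simps)
    moreover have "real (Suc m) * ?S * (fact m * esym V x m) \<le> real (Suc m) * ?S * ?L ^ m"
      using S by (intro mult_left_mono fact_esym_le) auto
    ultimately show ?thesis by linarith
  qed
  show ?thesis
  proof (induction l)
    case 0
    have "(\<Sum>a | a \<subseteq> V \<and> card a = 0. prod x a * sum x a) = 0"
      using V by (intro sum.neutral) (auto dest: finite_subset)
    then have "esym V x 1 = ?L"
      using esym_Suc[of 0] V by simp
    then show ?case using step[of 0] by (simp add: power2_eq_square numeral_2_eq_2)
  next
    case (Suc l)
    have "?L * (?L ^ (l + 2) - real (l + 1) * real (l + 2) / 2 * ?S * ?L ^ l)
       \<le> ?L * (fact (l + 2) * esym V x (l + 2))"
      using L Suc by (intro mult_left_mono)
    moreover have "?L ^ (Suc l + 2) - real (Suc l + 1) * real (Suc l + 2) / 2 * ?S * ?L ^ Suc l =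
        ?L * (?L ^ (l + 2) - real (l + 1) * real (l + 2) / 2 * ?S * ?L ^ l) -
        real (Suc (Suc l)) * ?S * ?L ^ Suc l"
      by (simp add: algebra_simps add_divide_distrib)
    ultimately show ?case
      using step[of "Suc l"] unfolding add_2_eq_Suc' by linarith
  qed
qed

lemma sum_subsets_containing_le:
  assumes i: "i \<in> V"
  shows "(\<Sum>b | b \<subseteq> V \<and> card b = Suc l \<and> i \<in> b. prod x b) \<le> x i * esym V x l"
proof -
  have fin: "finite {b. b \<subseteq> V \<and> card b = m}" for m
    using V by (auto intro: finite_subset[of _ "Pow V"])
  have "(\<Sum>b | b \<subseteq> V \<and> card b = Suc l \<and> i \<in> b. prod x b) =
      (\<Sum>b | b \<subseteq> V \<and> card b = Suc l. \<Sum>j\<in>b. if j = i then x i * prod x (b - {j}) else 0)"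
    using V fin[of "Suc l"]
    by (intro sum.mono_neutral_cong_left)
       (auto simp: prod_remove_subset[symmetric] sum.delta' finite_subset[OF _ V])
  also have "\<dots> = (\<Sum>a | a \<subseteq> V \<and> card a = l. \<Sum>j\<in>V - a. if j = i then x i * prod x a else 0)"
    using sum_subsets_remove[OF V, where l = l and G = "\<lambda>a j. if j = i then x i * prod x a else 0"] by simp
  also have "\<dots> \<le> (\<Sum>a | a \<subseteq> V \<and> card a = l. x i * prod x a)"
    using V x i by (intro sum_mono) (auto simp: sum.delta' intro!: mult_nonneg_nonneg prod_nonneg)
  finally show ?thesis
    by (simp add: esym_def sum_distrib_left)
qed

end

section \<open>Exponential approximation of one group\<close>

text \<open>Both quantities lie between \<open>1 - r * t\<close> and \<open>1 - r * t + r\<^sup>2\<close>, and also between \<open>1 - r\<close> and 1. The bound \<open>r\<^sup>2\<close> is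
  what makes the error small; the bound \<open>r\<close> keeps it below the total odds, which is what dominates the
  sum over group sizes.\<close>

lemma bernoulli_exp_approx:
  fixes r t :: real
  assumes r: "0 \<le> r" and t: "0 \<le> t" "t \<le> 1"
  shows "\<bar>(1 - r / (1 + r) * t) - exp (- (r * t))\<bar> \<le> min r (r\<^sup>2)"
proof -
  define q where "q = r / (1 + r)"
  have q0: "0 \<le> q" and q1: "q \<le> r"
    using r by (auto simp: q_def field_simps)
  have q2: "r - q \<le> r\<^sup>2"
    using r by (auto simp: q_def field_simps power2_eq_square)
  have rt: "0 \<le> r * t" "r * t \<le> r"
    using r t by (auto simp: mult_left_le)
  have e1: "1 - r * t \<le> exp (- (r * t))"
    using exp_ge_add_one_self[of "- (r * t)"] by simp
  have e2: "exp (- (r * t)) \<le> 1"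
    using rt by simp
  have qt: "0 \<le> q * t" "q * t \<le> r * t"
    using q0 q1 t by (auto intro: mult_right_mono)
  have "(r - q) * t \<le> r\<^sup>2 * 1"
    using q1 q2 t by (intro mult_mono) auto
  then have q3: "r * t - q * t \<le> r\<^sup>2"
    by (simp add: algebra_simps)
  have "exp (- (r * t)) \<le> 1 / (1 + r * t)"
    using exp_ge_add_one_self[of "r * t"] rt by (simp add: exp_minus field_simps)
  also have "\<dots> \<le> 1 - r * t + (r * t)\<^sup>2"
  proof -
    have "(1 - u + u\<^sup>2) * (1 + u) = 1 + u ^ 3" for u :: real
      by (simp add: algebra_simps power2_eq_square power3_eq_cube)
    then have "1 \<le> (1 - r * t + (r * t)\<^sup>2) * (1 + r * t)"
      using rt by simp
    then show ?thesis
      using rt by (simp add: pos_divide_le_eq)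
  qed
  also have "(r * t)\<^sup>2 \<le> r\<^sup>2"
    using rt by (intro power_mono) auto
  finally have e3: "exp (- (r * t)) \<le> 1 - r * t + r\<^sup>2" by simp
  have "\<bar>(1 - q * t) - exp (- (r * t))\<bar> \<le> r" "\<bar>(1 - q * t) - exp (- (r * t))\<bar> \<le> r\<^sup>2"
    unfolding abs_le_iff using e1 e2 e3 qt q3 rt by linarith+
  then show ?thesis
    by (simp add: q_def)
qed

lemma abs_exp_minus_diff_le:
  fixes x y :: real
  assumes "0 \<le> x" "0 \<le> y"
  shows "\<bar>exp (- x) - exp (- y)\<bar> \<le> \<bar>x - y\<bar>"
proof -
  have *: "exp (- a) - exp (- b) \<le> b - a" if "0 \<le> a" "a \<le> b" for a b :: real
  proof -
    have "exp (- a) - exp (- b) = exp (- a) * (1 - exp (- (b - a)))"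
      by (simp add: algebra_simps flip: exp_add)
    also have "\<dots> \<le> 1 * (b - a)"
    proof (rule mult_mono)
      show "1 - exp (- (b - a)) \<le> b - a"
        using exp_ge_add_one_self[of "- (b - a)"] by linarith
    qed (use that in auto)
    finally show ?thesis by simp
  qed
  show ?thesis
    using *[of x y] *[of y x] assms by (cases x y rule: linorder_cases) (auto simp: abs_if)
qed

section \<open>Degrees for a fixed number of vertices\<close>

text \<open>The odds \<open>q / (1 - q)\<close> of the probability \<open>q = on_prob p n w a\<close>. Unlike that probability they are a
  product over the vertices of \<open>a\<close>, up to a factor that depends only on \<open>card a\<close> and the total weight.\<close>

definition group_odds :: "nat pmf \<Rightarrow> nat \<Rightarrow> (nat \<Rightarrow> real) \<Rightarrow> nat set \<Rightarrow> real" where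
  "group_odds p n w a = group_factor p (card a) * (\<Prod>i\<in>a. w i) / total_weight n w ^ (card a - 1)"

text \<open>The exponent of the limiting compound Poisson law per unit of weight: groups of size \<open>l\<close> arrive at
  rate \<open>l * pmf p l\<close> and add \<open>l - 1\<close> to the degree. The terms with \<open>l < 2\<close> vanish, also with truncated
  subtraction.\<close>

definition mark_exponent :: "nat pmf \<Rightarrow> real \<Rightarrow> real" where
  "mark_exponent p s = (\<Sum>l. real l * pmf p l * (1 - s ^ (l - 1)))"

definition size_groups :: "nat \<Rightarrow> nat \<Rightarrow> nat set set" where
  "size_groups n l = {a. a \<subseteq> {1..n} \<and> card a = l}"

text \<open>One nonnegative quantity that holds two errors made for the groups of size \<open>l\<close> that contain \<open>i\<close>: the
  amount by which their odds fall short of \<open>l * pmf p l * w i\<close>, and the errors \<open>min r (r\<^sup>2)\<close> of the exponential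
  approximation.\<close>

definition odds_defect :: "nat pmf \<Rightarrow> nat \<Rightarrow> (nat \<Rightarrow> real) \<Rightarrow> nat \<Rightarrow> nat \<Rightarrow> real" where
  "odds_defect p n w i l = real l * pmf p l * w i -
     (\<Sum>a | a \<in> size_groups n l \<and> i \<in> a. group_odds p n w a - min (group_odds p n w a) ((group_odds p n w a)\<^sup>2))"

lemma finite_size_groups [simp]: "finite (size_groups n l)"
  unfolding size_groups_def by (auto intro: finite_subset[of _ "Pow {1..n}"])

lemma degree_eq_sum:
  "degree n \<omega> i = (\<Sum>a | a \<in> groups n \<and> i \<in> a. if \<omega> a then card a - 1 else 0)"
proof -
  have "degree n \<omega> i = (\<Sum>k\<in>{2..n}. \<Sum>a | a \<in> {a. a \<in> groups n \<and> i \<in> a} \<and> card a = k.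
      if \<omega> a then card a - 1 else 0)"
    unfolding degree_eq_sum_groups by (intro sum.cong) (auto simp: groups_def)
  also have "\<dots> = (\<Sum>a | a \<in> groups n \<and> i \<in> a. if \<omega> a then card a - 1 else 0)"
  proof (rule sum.group)
    show "card ` {a. a \<in> groups n \<and> i \<in> a} \<subseteq> {2..n}"
      using card_mono[of "{1..n}"] by (fastforce simp: groups_def)
  qed (auto simp: finite_groups)
  finally show ?thesis .
qed

lemma power_degree_eq_prod:
  fixes s :: real
  shows "s ^ degree n \<omega> i = (\<Prod>a\<in>groups n. if \<omega> a \<and> i \<in> a then s ^ (card a - 1) else 1)"
proof -
  have "s ^ degree n \<omega> i = (\<Prod>a | a \<in> groups n \<and> i \<in> a. s ^ (if \<omega> a then card a - 1 else 0))"
    by (simp add: degree_eq_sum power_sum)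
  also have "\<dots> = (\<Prod>a\<in>groups n. if \<omega> a \<and> i \<in> a then s ^ (card a - 1) else 1)"
    by (rule prod.mono_neutral_cong_left) (auto simp: finite_groups)
  finally show ?thesis .
qed

lemma finite_set_group_pmf: "finite (set_pmf (group_pmf p n w))"
  unfolding group_pmf_def
  by (rule finite_subset[OF set_Pi_pmf_subset'[OF finite_groups]])
     (auto intro!: finite_PiE_dflt simp: finite_groups)

lemma integrable_group_pmf [simp]:
  fixes f :: "(nat set \<Rightarrow> bool) \<Rightarrow> real"
  shows "integrable (measure_pmf (group_pmf p n w)) f"
  by (rule integrable_measure_pmf_finite[OF finite_set_group_pmf])

text \<open>The sum by size is indexed by all \<open>l\<close> so that it can be compared with the series over the group sizes
  of the limit law; sizes above \<open>n\<close> contribute empty sums.\<close>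

lemma sums_by_size:
  fixes g :: "nat set \<Rightarrow> real"
  assumes g: "\<And>a. card a < 2 \<Longrightarrow> g a = 0"
  shows "(\<lambda>l. \<Sum>a | a \<in> size_groups n l \<and> P a. g a) sums (\<Sum>a | a \<in> groups n \<and> P a. g a)"
proof -
  have z: "(\<Sum>a | a \<in> size_groups n l \<and> P a. g a) = 0" if "l \<notin> {2..n}" for l
  proof (rule sum.neutral, rule ballI)
    fix a assume "a \<in> {a. a \<in> size_groups n l \<and> P a}"
    then have "a \<subseteq> {1..n}" "card a = l" by (auto simp: size_groups_def)
    then show "g a = 0"
      using that g[of a] card_mono[of "{1..n}" a] by (cases "l < 2") auto
  qed
  have "(\<lambda>l. \<Sum>a | a \<in> size_groups n l \<and> P a. g a) sums
      (\<Sum>l\<in>{2..n}. \<Sum>a | a \<in> size_groups n l \<and> P a. g a)"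
    using z by (intro sums_finite) auto
  also have "(\<Sum>l\<in>{2..n}. \<Sum>a | a \<in> size_groups n l \<and> P a. g a) =
      (\<Sum>l\<in>{2..n}. \<Sum>a | a \<in> {a. a \<in> groups n \<and> P a} \<and> card a = l. g a)"
    by (intro sum.cong) (auto simp: groups_def size_groups_def)
  also have "\<dots> = (\<Sum>a | a \<in> groups n \<and> P a. g a)"
  proof (rule sum.group)
    show "card ` {a. a \<in> groups n \<and> P a} \<subseteq> {2..n}"
      using card_mono[of "{1..n}"] by (fastforce simp: groups_def)
  qed (auto simp: finite_groups)
  finally show ?thesis .
qed

lemma summable_mark_exponent:
  assumes p: "summable (\<lambda>k. real k * pmf p k)" and s: "0 \<le> s" "s \<le> 1"
  shows "summable (\<lambda>l. real l * pmf p l * (1 - s ^ (l - 1)))"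
proof (rule summable_comparison_test'[OF p, of 0])
  fix l :: nat
  have t: "0 \<le> 1 - s ^ (l - 1)" "1 - s ^ (l - 1) \<le> 1"
    using s by (auto simp: power_le_one)
  then have "real l * pmf p l * (1 - s ^ (l - 1)) \<le> real l * pmf p l * 1"
    by (intro mult_left_mono) auto
  then show "norm (real l * pmf p l * (1 - s ^ (l - 1))) \<le> real l * pmf p l"
    using t by (simp add: abs_mult)
qed

lemma mark_exponent_nonneg:
  assumes "summable (\<lambda>k. real k * pmf p k)" "0 \<le> s" "s \<le> 1"
  shows "0 \<le> mark_exponent p s"
  unfolding mark_exponent_def using assms
  by (intro suminf_nonneg summable_mark_exponent mult_nonneg_nonneg) (auto simp: power_le_one)

text \<open>Bernoulli's inequality in each term. Letting \<open>s\<close> tend to 1 shows later that the limit law has no mass at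
  infinity.\<close>

lemma mark_exponent_le:
  assumes p: "summable (\<lambda>k. real k * pmf p k)" and p2: "summable (\<lambda>k. real k ^ 2 * pmf p k)"
    and s: "0 \<le> s" "s \<le> 1"
  shows "mark_exponent p s \<le> (1 - s) * (\<Sum>k. real k ^ 2 * pmf p k)"
proof -
  have "mark_exponent p s \<le> (\<Sum>k. (1 - s) * (real k ^ 2 * pmf p k))"
    unfolding mark_exponent_def
  proof (rule suminf_le)
    fix l :: nat
    have "1 + real (l - 1) * (s - 1) \<le> (1 + (s - 1)) ^ (l - 1)"
      using s by (intro Bernoulli_inequality) auto
    then have "1 - s ^ (l - 1) \<le> real (l - 1) * (1 - s)"
      by (simp add: algebra_simps)
    also have "\<dots> \<le> real l * (1 - s)"
      using s by (intro mult_right_mono) auto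
    finally have "real l * pmf p l * (1 - s ^ (l - 1)) \<le> real l * pmf p l * (real l * (1 - s))"
      by (intro mult_left_mono) auto
    then show "real l * pmf p l * (1 - s ^ (l - 1)) \<le> (1 - s) * (real l ^ 2 * pmf p l)"
      by (simp add: power2_eq_square mult_ac)
  qed (intro summable_mark_exponent p s summable_mult p2)+
  then show ?thesis
    by (simp add: suminf_mult p2)
qed

locale inhomogeneous_groups =
  fixes p :: "nat pmf" and n :: nat and w :: "nat \<Rightarrow> real"
  assumes p_support: "set_pmf p \<subseteq> {2..}"
    and p_mean: "summable (\<lambda>k. real k * pmf p k)"
    and w_nonneg: "\<And>i. i \<in> {1..n} \<Longrightarrow> 0 \<le> w i"
    and total_pos: "0 < total_weight n w"
begin

abbreviation "L \<equiv> total_weight n w"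
abbreviation "S2 \<equiv> \<Sum>i\<in>{1..n}. (w i)\<^sup>2"
abbreviation "r \<equiv> group_odds p n w"

lemma pmf_small: "l < 2 \<Longrightarrow> pmf p l = 0"
  using p_support by (auto simp: set_pmf_iff)

lemma odds_small: "card a < 2 \<Longrightarrow> r a = 0"
  by (simp add: group_odds_def group_factor_def pmf_small)

lemma odds_nonneg: "a \<subseteq> {1..n} \<Longrightarrow> 0 \<le> r a"
  unfolding group_odds_def group_factor_def using total_pos w_nonneg
  by (intro divide_nonneg_nonneg mult_nonneg_nonneg prod_nonneg) auto

lemma on_prob_eq: "on_prob p n w a = r a / (1 + r a)"
  using total_pos by (simp add: on_prob_def group_odds_def field_simps)

lemma on_prob_bounds: "a \<subseteq> {1..n} \<Longrightarrow> 0 \<le> on_prob p n w a \<and> on_prob p n w a \<le> 1 \<and> on_prob p n w a \<le> r a"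
  unfolding on_prob_eq using odds_nonneg[of a] by (auto simp: field_simps)

lemma expectation_power_degree:
  fixes s :: real
  assumes s: "0 \<le> s"
  shows "measure_pmf.expectation (group_pmf p n w) (\<lambda>\<omega>. s ^ degree n \<omega> i) =
    (\<Prod>a\<in>groups n. if i \<in> a then 1 - on_prob p n w a * (1 - s ^ (card a - 1)) else 1)"
proof -
  have "measure_pmf.expectation (group_pmf p n w) (\<lambda>\<omega>. s ^ degree n \<omega> i) =
     (\<Prod>a\<in>groups n. measure_pmf.expectation (bernoulli_pmf (on_prob p n w a))
        (\<lambda>b. if b \<and> i \<in> a then s ^ (card a - 1) else 1))"
    unfolding power_degree_eq_prod group_pmf_def
    by (rule expectation_prod_Pi_pmf) (use s in \<open>auto simp: finite_groups intro: integrable_measure_pmf_finite\<close>)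
  also have "\<dots> = (\<Prod>a\<in>groups n. if i \<in> a then 1 - on_prob p n w a * (1 - s ^ (card a - 1)) else 1)"
    using on_prob_bounds by (intro prod.cong refl) (auto simp: groups_def algebra_simps)
  finally show ?thesis .
qed

lemma expectation_power_degree2:
  fixes s :: real
  assumes s: "0 \<le> s"
  shows "measure_pmf.expectation (group_pmf p n w) (\<lambda>\<omega>. s ^ degree n \<omega> i * s ^ degree n \<omega> j) =
    (\<Prod>a\<in>groups n. if i \<in> a \<and> j \<in> a then 1 - on_prob p n w a * (1 - (s ^ (card a - 1))\<^sup>2)
      else if i \<in> a \<or> j \<in> a then 1 - on_prob p n w a * (1 - s ^ (card a - 1)) else 1)"
proof -
  have "measure_pmf.expectation (group_pmf p n w) (\<lambda>\<omega>. s ^ degree n \<omega> i * s ^ degree n \<omega> j) =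
     (\<Prod>a\<in>groups n. measure_pmf.expectation (bernoulli_pmf (on_prob p n w a))
        (\<lambda>b. (if b \<and> i \<in> a then s ^ (card a - 1) else 1) * (if b \<and> j \<in> a then s ^ (card a - 1) else 1)))"
    unfolding power_degree_eq_prod group_pmf_def prod.distrib[symmetric]
    by (rule expectation_prod_Pi_pmf) (use s in \<open>auto simp: finite_groups intro: integrable_measure_pmf_finite\<close>)
  also have "\<dots> = (\<Prod>a\<in>groups n. if i \<in> a \<and> j \<in> a then 1 - on_prob p n w a * (1 - (s ^ (card a - 1))\<^sup>2)
      else if i \<in> a \<or> j \<in> a then 1 - on_prob p n w a * (1 - s ^ (card a - 1)) else 1)"
    using on_prob_bounds by (intro prod.cong refl) (auto simp: groups_def algebra_simps power2_eq_square)
  finally show ?thesis .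
qed

lemma power_unit: "0 \<le> (s::real) \<Longrightarrow> s \<le> 1 \<Longrightarrow> 0 \<le> s ^ m \<and> s ^ m \<le> 1"
  by (auto intro: power_le_one)

lemma unit_interp: "0 \<le> (x::real) \<Longrightarrow> x \<le> 1 \<Longrightarrow> 0 \<le> y \<Longrightarrow> y \<le> 1 \<Longrightarrow> 0 \<le> 1 - x * (1 - y) \<and> 1 - x * (1 - y) \<le> 1"
  using mult_mono[of x 1 "1 - y" 1] mult_nonneg_nonneg[of x "1 - y"] by auto

text \<open>The two products over the groups differ only in the factors of groups that contain both vertices;
  there the difference is the variance of a variable that equals \<open>s ^ (card a - 1)\<close> with probability
  \<open>on_prob p n w a\<close> and 1 otherwise, hence at most that probability and at most the odds.
  A telescoping bound for products of numbers in the unit interval adds these up.\<close>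

lemma covariance_power_degree:
  fixes s :: real
  assumes s: "0 \<le> s" "s \<le> 1"
  shows "\<bar>measure_pmf.expectation (group_pmf p n w) (\<lambda>\<omega>. s ^ degree n \<omega> i * s ^ degree n \<omega> j) -
     measure_pmf.expectation (group_pmf p n w) (\<lambda>\<omega>. s ^ degree n \<omega> i) *
     measure_pmf.expectation (group_pmf p n w) (\<lambda>\<omega>. s ^ degree n \<omega> j)\<bar>
    \<le> (\<Sum>a | a \<in> groups n \<and> i \<in> a \<and> j \<in> a. r a)"
proof -
  let ?q = "on_prob p n w" and ?y = "\<lambda>a. s ^ (card a - 1)"
  let ?A = "\<lambda>a. if i \<in> a \<and> j \<in> a then 1 - ?q a * (1 - (?y a)\<^sup>2)
      else if i \<in> a \<or> j \<in> a then 1 - ?q a * (1 - ?y a) else 1"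
  let ?B = "\<lambda>i a. if i \<in> a then 1 - ?q a * (1 - ?y a) else 1"
  have q: "0 \<le> ?q a" "?q a \<le> 1" "?q a \<le> r a" if "a \<in> groups n" for a
    using that on_prob_bounds by (auto simp: groups_def)
  have y: "0 \<le> ?y a" "?y a \<le> 1" "0 \<le> (?y a)\<^sup>2" "(?y a)\<^sup>2 \<le> 1" for a
    using s by (auto simp: power_le_one)
  have "\<bar>(\<Prod>a\<in>groups n. ?A a) - (\<Prod>a\<in>groups n. ?B i a * ?B j a)\<bar> \<le>
      (\<Sum>a\<in>groups n. \<bar>?A a - ?B i a * ?B j a\<bar>)"
    unfolding real_norm_def[symmetric]
  proof (rule norm_prod_diff)
    fix a assume a: "a \<in> groups n"
    have B: "0 \<le> ?B i a \<and> ?B i a \<le> 1" for i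
      using unit_interp[OF q(1,2)[OF a] y(1,2)] by auto
    show "norm (?A a) \<le> 1"
      using unit_interp[OF q(1,2)[OF a] y(1,2)[of a]] unit_interp[OF q(1,2)[OF a] y(3,4)[of a]] by auto
    show "norm (?B i a * ?B j a) \<le> 1"
      using B[of i] B[of j] unfolding real_norm_def abs_mult
      by (intro mult_le_one) auto
  qed
  also have "\<dots> \<le> (\<Sum>a\<in>groups n. if i \<in> a \<and> j \<in> a then r a else 0)"
  proof (rule sum_mono)
    fix a assume a: "a \<in> groups n"
    have "?A a - ?B i a * ?B j a = ?q a * (1 - ?q a) * (1 - ?y a)\<^sup>2" if "i \<in> a" "j \<in> a"
      using that by (simp add: algebra_simps power2_eq_square)
    moreover have "?q a * (1 - ?q a) * (1 - ?y a)\<^sup>2 \<le> ?q a * 1 * 1"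
      using q[OF a] y[of a] by (intro mult_mono) (auto simp: power_le_one)
    moreover have "0 \<le> ?q a * (1 - ?q a) * (1 - ?y a)\<^sup>2"
      using q[OF a] by auto
    ultimately show "\<bar>?A a - ?B i a * ?B j a\<bar> \<le> (if i \<in> a \<and> j \<in> a then r a else 0)"
      using q(3)[OF a] by auto
  qed
  also have "\<dots> = (\<Sum>a | a \<in> groups n \<and> i \<in> a \<and> j \<in> a. r a)"
    by (simp add: sum.If_cases finite_groups Int_def)
  finally show ?thesis
    using s by (simp add: expectation_power_degree expectation_power_degree2 prod.distrib)
qed

lemma summable_size_bias: "summable (\<lambda>l. real l * pmf p l * c)" for c
  using p_mean by (rule summable_mult2)

text \<open>Dropping the requirement that the other members differ from \<open>i\<close> and from each other bounds the sum by
  \<open>w i\<close> times a power of the total weight; the factorial in \<open>group_factor\<close> and the number of orderings of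
  the other members leave the factor \<open>l\<close>.\<close>

lemma sum_odds_containing_le:
  assumes i: "i \<in> {1..n}"
  shows "(\<Sum>a | a \<in> size_groups n l \<and> i \<in> a. r a) \<le> real l * pmf p l * w i"
proof (cases l)
  case 0
  have "(\<Sum>a | a \<in> size_groups n l \<and> i \<in> a. r a) = 0"
    using 0 by (intro sum.neutral) (auto simp: size_groups_def odds_small)
  then show ?thesis using 0 by simp
next
  case (Suc m)
  have "(\<Sum>a | a \<in> size_groups n l \<and> i \<in> a. r a) =
      group_factor p l / L ^ m * (\<Sum>a | a \<subseteq> {1..n} \<and> card a = Suc m \<and> i \<in> a. prod w a)"
    unfolding sum_distrib_left
    by (intro sum.cong) (auto simp: size_groups_def group_odds_def Suc)
  also have "\<dots> \<le> group_factor p l / L ^ m * (w i * (L ^ m / fact m))"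
  proof (rule mult_left_mono)
    have "(\<Sum>a | a \<subseteq> {1..n} \<and> card a = Suc m \<and> i \<in> a. prod w a) \<le> w i * esym {1..n} w m"
      using w_nonneg i by (intro sum_subsets_containing_le) auto
    also have "fact m * esym {1..n} w m \<le> L ^ m"
      using fact_esym_le[of "{1..n}" w m] w_nonneg by (simp add: total_weight_def)
    then have "w i * esym {1..n} w m \<le> w i * (L ^ m / fact m)"
      using w_nonneg[OF i] by (intro mult_left_mono) (auto simp: field_simps)
    finally show "(\<Sum>a | a \<subseteq> {1..n} \<and> card a = Suc m \<and> i \<in> a. prod w a) \<le> w i * (L ^ m / fact m)" .
  qed (use total_pos in \<open>auto simp: group_factor_def\<close>)
  also have "\<dots> = real l * pmf p l * w i"
    using total_pos by (simp add: group_factor_def Suc fact_reduce field_simps)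
  finally show ?thesis .
qed

lemma odds_defect_bounds:
  assumes i: "i \<in> {1..n}"
  shows "0 \<le> odds_defect p n w i l" "odds_defect p n w i l \<le> real l * pmf p l * w i"
proof -
  have r: "a \<in> size_groups n l \<Longrightarrow> 0 \<le> r a" for a
    using odds_nonneg[of a] by (auto simp: size_groups_def)
  have "(\<Sum>a | a \<in> size_groups n l \<and> i \<in> a. r a - min (r a) ((r a)\<^sup>2)) \<le>
        (\<Sum>a | a \<in> size_groups n l \<and> i \<in> a. r a)"
    using r by (intro sum_mono) auto
  then show "0 \<le> odds_defect p n w i l"
    using sum_odds_containing_le[OF i, of l] by (simp add: odds_defect_def)
  have "0 \<le> (\<Sum>a | a \<in> size_groups n l \<and> i \<in> a. r a - min (r a) ((r a)\<^sup>2))"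
    by (intro sum_nonneg) auto
  then show "odds_defect p n w i l \<le> real l * pmf p l * w i"
    by (simp add: odds_defect_def)
qed

lemma summable_odds_defect: "i \<in> {1..n} \<Longrightarrow> summable (odds_defect p n w i)"
  by (rule summable_comparison_test'[OF summable_size_bias[of "w i"], of 0])
     (use odds_defect_bounds in auto)

text \<open>Two replacements, each with an error contained in the defects: the Bernoulli factors by exponentials,
  and the sum of the odds in the exponent by its upper bound. In the second step all terms of the
  difference of exponents are nonnegative, so weights \<open>1 - s ^ (l - 1)\<close> in the unit interval can be
  dropped.\<close>

lemma expectation_power_degree_approx:
  fixes s :: real
  assumes s: "0 \<le> s" "s \<le> 1" and i: "i \<in> {1..n}"
  shows "\<bar>measure_pmf.expectation (group_pmf p n w) (\<lambda>\<omega>. s ^ degree n \<omega> i) -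
           exp (- (w i * mark_exponent p s))\<bar>
         \<le> (\<Sum>l. odds_defect p n w i l)"
proof -
  let ?t = "\<lambda>l. 1 - s ^ (l - 1)"
  let ?I = "{a. a \<in> groups n \<and> i \<in> a}"
  let ?m = "\<lambda>a. min (r a) ((r a)\<^sup>2)"
  let ?c = "\<Sum>l. real l * pmf p l * ?t l"
  let ?R = "\<lambda>l. \<Sum>a | a \<in> size_groups n l \<and> i \<in> a. r a"
  have t: "0 \<le> ?t l" "?t l \<le> 1" for l
    using s by (auto simp: power_le_one)
  have r: "0 \<le> r a" "0 \<le> on_prob p n w a" "on_prob p n w a \<le> 1" if "a \<in> ?I" for a
    using that odds_nonneg on_prob_bounds by (auto simp: groups_def)
  have fin: "finite ?I" by (simp add: finite_groups)
  have "(\<Prod>a\<in>groups n. if i \<in> a then 1 - on_prob p n w a * ?t (card a) else 1) =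
      (\<Prod>a\<in>?I. 1 - on_prob p n w a * ?t (card a))"
    by (rule prod.mono_neutral_cong_right) (auto simp: finite_groups)
  then have E: "measure_pmf.expectation (group_pmf p n w) (\<lambda>\<omega>. s ^ degree n \<omega> i) =
      (\<Prod>a\<in>?I. 1 - on_prob p n w a * ?t (card a))"
    using s by (simp add: expectation_power_degree)
  have "\<bar>(\<Prod>a\<in>?I. 1 - on_prob p n w a * ?t (card a)) - (\<Prod>a\<in>?I. exp (- (r a * ?t (card a))))\<bar>
      \<le> (\<Sum>a\<in>?I. \<bar>(1 - on_prob p n w a * ?t (card a)) - exp (- (r a * ?t (card a)))\<bar>)"
    unfolding real_norm_def[symmetric]
  proof (rule norm_prod_diff)
    fix a assume a: "a \<in> ?I"
    show "norm (1 - on_prob p n w a * ?t (card a)) \<le> 1"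
      using unit_interp[OF r(2,3)[OF a] conjunct1[OF power_unit[OF s]] conjunct2[OF power_unit[OF s]],
          of "card a - 1"] by simp
    show "norm (exp (- (r a * ?t (card a)))) \<le> 1"
      using r(1)[OF a] t(1) by simp
  qed
  also have "\<dots> \<le> (\<Sum>a\<in>?I. ?m a)"
    unfolding on_prob_eq using r t by (intro sum_mono bernoulli_exp_approx) auto
  finally have 1: "\<bar>(\<Prod>a\<in>?I. 1 - on_prob p n w a * ?t (card a)) - exp (- (\<Sum>a\<in>?I. r a * ?t (card a)))\<bar>
      \<le> (\<Sum>a\<in>?I. ?m a)"
    using fin by (simp add: exp_sum flip: sum_negf)
  have sumc: "summable (\<lambda>l. real l * pmf p l * ?t l)"
    by (rule summable_mark_exponent[OF p_mean s])
  have c0: "0 \<le> ?c"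
    using mark_exponent_nonneg[OF p_mean s] by (simp add: mark_exponent_def)
  have "(\<lambda>l. real l * pmf p l * ?t l * w i) sums (?c * w i)"
    using sumc by (intro sums_mult2 summable_sums)
  moreover have "(\<lambda>l. \<Sum>a | a \<in> size_groups n l \<and> i \<in> a. r a * ?t (card a)) sums (\<Sum>a\<in>?I. r a * ?t (card a))"
    by (intro sums_by_size) (simp add: odds_small)
  ultimately have "(\<lambda>l. real l * pmf p l * ?t l * w i - (\<Sum>a | a \<in> size_groups n l \<and> i \<in> a. r a * ?t (card a)))
     sums (?c * w i - (\<Sum>a\<in>?I. r a * ?t (card a)))"
    by (rule sums_diff)
  also have "(\<lambda>l. real l * pmf p l * ?t l * w i - (\<Sum>a | a \<in> size_groups n l \<and> i \<in> a. r a * ?t (card a)))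
      = (\<lambda>l. ?t l * (real l * pmf p l * w i - ?R l))"
    by (auto simp: size_groups_def sum_distrib_left algebra_simps intro!: ext sum.cong)
  finally have d: "(\<lambda>l. ?t l * (real l * pmf p l * w i - ?R l)) sums (?c * w i - (\<Sum>a\<in>?I. r a * ?t (card a)))" .
  have R: "?R l \<le> real l * pmf p l * w i" for l
    by (rule sum_odds_containing_le[OF i])
  have "?R sums (\<Sum>a\<in>?I. r a)" 
    by (intro sums_by_size) (simp add: odds_small)
  with summable_sums[OF summable_size_bias[of "w i"]]
  have d': "(\<lambda>l. real l * pmf p l * w i - ?R l) sums ((\<Sum>l. real l * pmf p l * w i) - (\<Sum>a\<in>?I. r a))"
    by (rule sums_diff)
  have M: "(\<lambda>l. \<Sum>a | a \<in> size_groups n l \<and> i \<in> a. ?m a) sums (\<Sum>a\<in>?I. ?m a)"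
    by (intro sums_by_size) (simp add: odds_small)
  have D: "(\<Sum>l. odds_defect p n w i l) = ((\<Sum>l. real l * pmf p l * w i) - (\<Sum>a\<in>?I. r a)) + (\<Sum>a\<in>?I. ?m a)"
    using sums_add[OF d' M] unfolding odds_defect_def sum_subtractf
    by (simp add: sums_iff algebra_simps)
  have "\<bar>exp (- (\<Sum>a\<in>?I. r a * ?t (card a))) - exp (- (w i * ?c))\<bar> \<le> \<bar>(\<Sum>a\<in>?I. r a * ?t (card a)) - w i * ?c\<bar>"
    using r t c0 w_nonneg[OF i] by (intro abs_exp_minus_diff_le sum_nonneg mult_nonneg_nonneg) auto
  also have "\<dots> = ?c * w i - (\<Sum>a\<in>?I. r a * ?t (card a))"
    using sums_le[OF _ sums_zero d] R t by (simp add: mult.commute abs_if)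
  also have "\<dots> \<le> (\<Sum>l. real l * pmf p l * w i) - (\<Sum>a\<in>?I. r a)"
    by (rule sums_le[OF _ d d']) (use R t in \<open>auto intro!: mult_left_le_one_le\<close>)
  finally show ?thesis
    using 1 D unfolding E mark_exponent_def by linarith
qed


lemma sum_over_members:
  fixes g :: "nat set \<Rightarrow> real"
  assumes "A \<subseteq> Pow {1..n}"
  shows "(\<Sum>i\<in>{1..n}. \<Sum>a | a \<in> A \<and> i \<in> a. g a) = (\<Sum>a\<in>A. real (card a) * g a)"
proof -
  have A: "finite A" using assms by (auto intro: finite_subset)
  have "(\<Sum>i\<in>{1..n}. \<Sum>a | a \<in> A \<and> i \<in> a. g a) = (\<Sum>i\<in>{1..n}. \<Sum>a\<in>A. if i \<in> a then g a else 0)"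
    using A by (simp add: sum.If_cases Int_def)
  also have "\<dots> = (\<Sum>a\<in>A. \<Sum>i\<in>{1..n}. if i \<in> a then g a else 0)"
    by (rule sum.swap)
  also have "\<dots> = (\<Sum>a\<in>A. real (card a) * g a)"
  proof (intro sum.cong refl)
    fix a assume "a \<in> A"
    then have "{1..n} \<inter> {i. i \<in> a} = a" using assms by auto
    then show "(\<Sum>i\<in>{1..n}. if i \<in> a then g a else 0) = real (card a) * g a"
      by (simp add: sum.If_cases)
  qed
  finally show ?thesis .
qed

lemma size_groups_Pow: "size_groups n l \<subseteq> Pow {1..n}"
  by (auto simp: size_groups_def)

lemma card_size_groups: "a \<in> size_groups n l \<Longrightarrow> card a = l"
  by (simp add: size_groups_def)

lemma sum_odds_size_le: "real l * (\<Sum>a\<in>size_groups n l. r a) \<le> real l * pmf p l * L"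
proof -
  have "real l * (\<Sum>a\<in>size_groups n l. r a) = (\<Sum>i\<in>{1..n}. \<Sum>a | a \<in> size_groups n l \<and> i \<in> a. r a)"
    unfolding sum_over_members[OF size_groups_Pow] by (simp add: card_size_groups sum_distrib_left)
  also have "\<dots> \<le> (\<Sum>i\<in>{1..n}. real l * pmf p l * w i)"
    by (intro sum_mono sum_odds_containing_le)
  finally show ?thesis by (simp add: total_weight_def sum_distrib_left)
qed

text \<open>Each diagonal term is at most 1. Summed over pairs of vertices, the odds of the groups that contain
  both are the odds of all groups weighted by the squared size, which is at most the total weight times
  the second moment of \<open>p\<close>.\<close>

lemma variance_degree_transform:
  fixes s :: real
  assumes s: "0 \<le> s" "s \<le> 1" and p2: "summable (\<lambda>k. real k ^ 2 * pmf p k)"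
  defines "G \<equiv> \<lambda>\<omega>. \<Sum>i\<in>{1..n}. s ^ degree n \<omega> i"
  shows "measure_pmf.expectation (group_pmf p n w) (\<lambda>\<omega>. (G \<omega>)\<^sup>2) -
      (measure_pmf.expectation (group_pmf p n w) G)\<^sup>2
    \<le> real n + L * (\<Sum>k. real k ^ 2 * pmf p k)"
proof -
  let ?E = "measure_pmf.expectation (group_pmf p n w)"
  let ?V = "\<lambda>i \<omega>. s ^ degree n \<omega> i"
  have "?E (\<lambda>\<omega>. (G \<omega>)\<^sup>2) - (?E G)\<^sup>2 =
      (\<Sum>i\<in>{1..n}. \<Sum>j\<in>{1..n}. ?E (\<lambda>\<omega>. ?V i \<omega> * ?V j \<omega>) - ?E (?V i) * ?E (?V j))"
    by (simp add: G_def power2_eq_square sum_product sum_subtractf)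
  also have "\<dots> \<le> (\<Sum>i\<in>{1..n}. \<Sum>j\<in>{1..n}. if j = i then 1 else \<Sum>a | a \<in> groups n \<and> i \<in> a \<and> j \<in> a. r a)"
  proof (intro sum_mono)
    fix i j
    have "?E (\<lambda>\<omega>. ?V i \<omega> * ?V i \<omega>) \<le> ?E (\<lambda>\<omega>. 1)"
      using s by (intro integral_mono) (auto intro!: mult_le_one power_le_one)
    then have "?E (\<lambda>\<omega>. ?V i \<omega> * ?V i \<omega>) - ?E (?V i) * ?E (?V i) \<le> 1"
      using zero_le_square[of "?E (?V i)"] by (simp del: zero_le_square)
    with covariance_power_degree[OF s, of i j]
    show "?E (\<lambda>\<omega>. ?V i \<omega> * ?V j \<omega>) - ?E (?V i) * ?E (?V j) \<le>
        (if j = i then 1 else \<Sum>a | a \<in> groups n \<and> i \<in> a \<and> j \<in> a. r a)"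
      by auto
  qed
  also have "\<dots> = (\<Sum>i\<in>{1..n}. 1 + (\<Sum>j\<in>{1..n} - {i}. \<Sum>a | a \<in> groups n \<and> i \<in> a \<and> j \<in> a. r a))"
    by (intro sum.cong refl) (simp add: sum.remove)
  also have "\<dots> = real n + (\<Sum>i\<in>{1..n}. \<Sum>j\<in>{1..n} - {i}. \<Sum>a | a \<in> groups n \<and> i \<in> a \<and> j \<in> a. r a)"
    by (simp add: sum.distrib)
  also have "(\<Sum>i\<in>{1..n}. \<Sum>j\<in>{1..n} - {i}. \<Sum>a | a \<in> groups n \<and> i \<in> a \<and> j \<in> a. r a)
      \<le> (\<Sum>i\<in>{1..n}. \<Sum>j\<in>{1..n}. \<Sum>a | a \<in> groups n \<and> i \<in> a \<and> j \<in> a. r a)"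
    using odds_nonneg by (intro sum_mono sum_mono2 sum_nonneg) (auto simp: groups_def)
  also have "\<dots> = (\<Sum>i\<in>{1..n}. \<Sum>j\<in>{1..n}. \<Sum>a | a \<in> {a \<in> groups n. i \<in> a} \<and> j \<in> a. r a)"
    by (intro sum.cong) auto
  also have "\<dots> = (\<Sum>i\<in>{1..n}. \<Sum>a | a \<in> groups n \<and> i \<in> a. real (card a) * r a)"
    by (intro sum.cong refl sum_over_members) (auto simp: groups_def)
  also have "\<dots> = (\<Sum>a\<in>groups n. real (card a) * (real (card a) * r a))"
    by (intro sum_over_members) (auto simp: groups_def)
  also have "\<dots> \<le> (\<Sum>k. real k ^ 2 * pmf p k * L)"
  proof (rule sums_le[OF _ _ summable_sums])
    show "(\<lambda>l. \<Sum>a\<in>size_groups n l. real (card a) * (real (card a) * r a)) sums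
        (\<Sum>a\<in>groups n. real (card a) * (real (card a) * r a))"
      using sums_by_size[of "\<lambda>a. real (card a) * (real (card a) * r a)" n "\<lambda>_. True"]
      by (simp add: odds_small)
    show "(\<Sum>a\<in>size_groups n l. real (card a) * (real (card a) * r a)) \<le> real l ^ 2 * pmf p l * L" for l
    proof -
      have "(\<Sum>a\<in>size_groups n l. real (card a) * (real (card a) * r a)) =
          real l * (real l * (\<Sum>a\<in>size_groups n l. r a))"
        by (simp add: card_size_groups sum_distrib_left)
      also have "\<dots> \<le> real l * (real l * pmf p l * L)"
        by (intro mult_left_mono sum_odds_size_le) auto
      finally show ?thesis by (simp add: power2_eq_square mult_ac)
    qed
  qed (intro summable_mult2 p2)
  finally show ?thesis
    using suminf_mult2[OF p2, of L] by (simp add: mult.commute)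
qed

lemma mean_degree_transform:
  fixes s :: real
  assumes s: "0 \<le> s" "s \<le> 1"
  shows "\<bar>measure_pmf.expectation (group_pmf p n w) (\<lambda>\<omega>. \<Sum>i\<in>{1..n}. s ^ degree n \<omega> i) -
           (\<Sum>i\<in>{1..n}. exp (- (w i * mark_exponent p s)))\<bar>
         \<le> (\<Sum>l. \<Sum>i\<in>{1..n}. odds_defect p n w i l)"
proof -
  let ?E = "measure_pmf.expectation (group_pmf p n w)"
  let ?e = "\<lambda>i. exp (- (w i * mark_exponent p s))"
  have "\<bar>?E (\<lambda>\<omega>. \<Sum>i\<in>{1..n}. s ^ degree n \<omega> i) - (\<Sum>i\<in>{1..n}. ?e i)\<bar> =
      \<bar>\<Sum>i\<in>{1..n}. ?E (\<lambda>\<omega>. s ^ degree n \<omega> i) - ?e i\<bar>"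
    by (simp add: sum_subtractf)
  also have "\<dots> \<le> (\<Sum>i\<in>{1..n}. \<bar>?E (\<lambda>\<omega>. s ^ degree n \<omega> i) - ?e i\<bar>)"
    by (rule sum_abs)
  also have "\<dots> \<le> (\<Sum>i\<in>{1..n}. \<Sum>l. odds_defect p n w i l)"
    by (intro sum_mono expectation_power_degree_approx s)
  also have "\<dots> = (\<Sum>l. \<Sum>i\<in>{1..n}. odds_defect p n w i l)"
    using summable_odds_defect by (intro suminf_sum[symmetric]) auto
  finally show ?thesis .
qed

lemma sum_odds_defect_bounds:
  shows "0 \<le> (\<Sum>i\<in>{1..n}. odds_defect p n w i l)"
    and "(\<Sum>i\<in>{1..n}. odds_defect p n w i l) \<le> real l * pmf p l * L"
  using odds_defect_bounds
  by (auto intro!: sum_nonneg sum_mono simp: total_weight_def sum_distrib_left)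

lemma squares_le: "S2 \<le> L\<^sup>2"
proof -
  have "sqrt S2 \<le> L"
    using L2_set_le_sum[of "{1..n}" w] w_nonneg by (simp add: L2_set_def total_weight_def)
  then show ?thesis
    using sqrt_le_D by blast
qed

text \<open>The first summand bounds the missing odds through the probability that a sample with replacement has
  a repetition; the second bounds the squared odds, using that an elementary symmetric sum of the squared
  weights is at most a power of their sum. For fixed group size and bounded \<open>S2 / L\<close> the right-hand side is
  bounded, hence negligible after division by the number of vertices.\<close>

lemma sum_odds_defect_le:
  "(\<Sum>i\<in>{1..n}. odds_defect p n w i (m + 2)) \<le>
     real (m + 2) * pmf p (m + 2) * (real (m + 1) * real (m + 2) / 2) * (S2 / L) +
     real (m + 2) * (group_factor p (m + 2))\<^sup>2 * (S2 / L)\<^sup>2"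
proof -
  let ?l = "m + 2" and ?c = "real (m + 1) * real (m + 2) / 2" and ?f = "group_factor p (m + 2)"
  have S: "0 \<le> S2" by (intro sum_nonneg) auto
  have "(\<Sum>i\<in>{1..n}. odds_defect p n w i ?l) =
      real ?l * pmf p ?l * L - real ?l * (\<Sum>a\<in>size_groups n ?l. r a - min (r a) ((r a)\<^sup>2))"
    unfolding odds_defect_def sum_subtractf[of _ _ "{1..n}"] sum_over_members[OF size_groups_Pow]
    by (simp add: card_size_groups total_weight_def sum_distrib_left)
  also have "\<dots> = (real ?l * pmf p ?l * L - real ?l * (\<Sum>a\<in>size_groups n ?l. r a)) +
      real ?l * (\<Sum>a\<in>size_groups n ?l. min (r a) ((r a)\<^sup>2))"
    by (simp add: sum_subtractf algebra_simps)
  also have "\<dots> \<le> real ?l * pmf p ?l * ?c * (S2 / L) + real ?l * ?f\<^sup>2 * (S2 / L)\<^sup>2"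
  proof (rule add_mono)
    have "(\<Sum>a\<in>size_groups n ?l. r a) = pmf p ?l / L ^ (m + 1) * (fact ?l * esym {1..n} w ?l)"
      unfolding esym_def sum_distrib_left size_groups_def
      by (intro sum.cong) (auto simp: group_odds_def group_factor_def)
    also have "\<dots> \<ge> pmf p ?l / L ^ (m + 1) * (L ^ ?l - ?c * S2 * L ^ m)"
      using fact_esym_ge[of "{1..n}" w m] w_nonneg total_pos
      by (intro mult_left_mono) (auto simp: total_weight_def simp del: fact_Suc)
    also have "pmf p ?l / L ^ (m + 1) * (L ^ ?l - ?c * S2 * L ^ m) = pmf p ?l * L - pmf p ?l * ?c * (S2 / L)"
      using total_pos by (simp add: field_simps)
    finally have "real ?l * (pmf p ?l * L - pmf p ?l * ?c * (S2 / L)) \<le> real ?l * (\<Sum>a\<in>size_groups n ?l. r a)"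
      by (intro mult_left_mono) auto
    then show "real ?l * pmf p ?l * L - real ?l * (\<Sum>a\<in>size_groups n ?l. r a) \<le>
        real ?l * pmf p ?l * ?c * (S2 / L)"
      unfolding right_diff_distrib mult.assoc diff_le_eq by (simp only: add.commute)
  next
    have "(\<Sum>a\<in>size_groups n ?l. min (r a) ((r a)\<^sup>2)) \<le> (\<Sum>a\<in>size_groups n ?l. (r a)\<^sup>2)"
      by (intro sum_mono) auto
    also have "\<dots> = ?f\<^sup>2 / (L ^ (m + 1))\<^sup>2 * esym {1..n} (\<lambda>i. (w i)\<^sup>2) ?l"
      unfolding esym_def sum_distrib_left size_groups_def
      by (intro sum.cong) (auto simp: group_odds_def power_divide power_mult_distrib prod_power_distrib)
    also have "\<dots> \<le> ?f\<^sup>2 / (L ^ (m + 1))\<^sup>2 * S2 ^ ?l"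
    proof (rule mult_left_mono)
      have "1 * esym {1..n} (\<lambda>i. (w i)\<^sup>2) ?l \<le> fact ?l * esym {1..n} (\<lambda>i. (w i)\<^sup>2) ?l"
        by (intro mult_right_mono esym_nonneg fact_ge_1) auto
      also have "\<dots> \<le> S2 ^ ?l"
        by (intro fact_esym_le) auto
      finally show "esym {1..n} (\<lambda>i. (w i)\<^sup>2) ?l \<le> S2 ^ ?l" by simp
    qed auto
    \<comment> \<open>Only two of the factors \<open>S2\<close> are kept; the others are absorbed by \<open>S2 \<le> L\<^sup>2\<close>.\<close>
    also have "\<dots> = ?f\<^sup>2 * (S2 / L)\<^sup>2 * (S2 / L\<^sup>2) ^ m"
      using total_pos by (simp add: field_simps power_add power2_eq_square power_mult_distrib)
    also have "\<dots> \<le> ?f\<^sup>2 * (S2 / L)\<^sup>2 * 1"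
      using S squares_le total_pos by (intro mult_left_mono power_le_one) auto
    finally have "real ?l * (\<Sum>a\<in>size_groups n ?l. min (r a) ((r a)\<^sup>2)) \<le> real ?l * (?f\<^sup>2 * (S2 / L)\<^sup>2)"
      by (intro mult_left_mono) auto
    then show "real ?l * (\<Sum>a\<in>size_groups n ?l. min (r a) ((r a)\<^sup>2)) \<le> real ?l * ?f\<^sup>2 * (S2 / L)\<^sup>2"
      by (simp add: mult_ac)
  qed
  finally show ?thesis .
qed

end

section \<open>The mixed Poisson limit law\<close>

definition poisson_mass :: "nat pmf \<Rightarrow> nat \<Rightarrow> real \<Rightarrow> nat \<Rightarrow> real" where
  "poisson_mass p l x k = exp (- (real l * pmf p l * x)) * (real l * pmf p l * x) ^ k / fact k"

lemma poisson_mass_nonneg: "0 \<le> x \<Longrightarrow> 0 \<le> poisson_mass p l x k"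
  by (simp add: poisson_mass_def)

lemma poisson_mass_measurable [measurable]: "(\<lambda>x. poisson_mass p l x k) \<in> borel_measurable borel"
  unfolding poisson_mass_def by measurable

lemma poisson_mass_transform:
  "(\<lambda>k. poisson_mass p l x k * u ^ k) sums exp (- (real l * pmf p l * x * (1 - u)))"
proof -
  let ?a = "real l * pmf p l * x"
  have "(\<lambda>k. exp (- ?a) * ((?a * u) ^ k /\<^sub>R fact k)) sums (exp (- ?a) * exp (?a * u))"
    by (intro sums_mult exp_converges)
  then show ?thesis
    by (simp add: poisson_mass_def field_simps power_mult_distrib flip: exp_add)
qed

text \<open>Nonnegativity of \<open>W\<close> makes the conditional laws genuine Poisson laws; in the theorem it is inherited from
  the vertex weights.\<close>

locale mixed_poisson_limit = prob_space M for M :: "'a measure" +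
  fixes p :: "nat pmf" and W :: "'a \<Rightarrow> real" and X :: "nat \<Rightarrow> 'a \<Rightarrow> nat"
  assumes p_mean: "summable (\<lambda>k. real k * pmf p k)"
    and p_square: "summable (\<lambda>k. real k ^ 2 * pmf p k)"
    and W_meas [measurable]: "W \<in> borel_measurable M"
    and W_nonneg: "AE \<omega> in M. 0 \<le> W \<omega>"
    and W_int: "integrable M W"
    and family: "mixed_poisson_family M p W X"
begin

lemma X_meas: "2 \<le> l \<Longrightarrow> X l \<in> measurable M (count_space UNIV)"
  using family by (auto simp: mixed_poisson_family_def)

lemma level_sets:
  assumes "finite L" "L \<subseteq> {2..}"
  shows "{\<omega> \<in> space M. \<forall>l\<in>L. X l \<omega> = k l} \<in> sets M"
proof (rule sets.sets_Collect_finite_All[OF _ \<open>finite L\<close>])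
  fix l assume "l \<in> L"
  then have "X l -` {k l} \<inter> space M \<in> sets M"
    using assms by (intro measurable_sets[OF X_meas]) auto
  also have "X l -` {k l} \<inter> space M = {\<omega> \<in> space M. X l \<omega> = k l}" by auto
  finally show "{\<omega> \<in> space M. X l \<omega> = k l} \<in> sets M" .
qed

text \<open>The conditional description enters only through this unconditional formula, obtained by integrating
  the conditional probability.\<close>

lemma joint_law:
  assumes L: "finite L" "L \<subseteq> {2..}"
  shows "(\<integral>\<^sup>+\<omega>. indicator {\<omega> \<in> space M. \<forall>l\<in>L. X l \<omega> = k l} \<omega> \<partial>M) =
    (\<integral>\<^sup>+\<omega>. ennreal (\<Prod>l\<in>L. poisson_mass p l (W \<omega>) (k l)) \<partial>M)"
proof -
  let ?F = "vimage_algebra (space M) W borel"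
  let ?A = "{\<omega> \<in> space M. \<forall>l\<in>L. X l \<omega> = k l}"
  let ?P = "\<lambda>\<omega>. \<Prod>l\<in>L. poisson_mass p l (W \<omega>) (k l)"
  have "subalgebra M ?F"
    by (auto simp: subalgebra_def sets_vimage_algebra2 measurable_sets)
  then interpret finite_measure_subalgebra M ?F
    by unfold_locales
  have A [measurable]: "?A \<in> sets M" using L by (rule level_sets)
  have int: "integrable M (indicat_real ?A)"
    by (auto simp: integrable_indicator_iff less_top[symmetric])
  have ae: "AE \<omega> in M. real_cond_exp M ?F (indicat_real ?A) \<omega> = ?P \<omega>"
    using family L unfolding mixed_poisson_family_def poisson_mass_def by blast
  have meas: "?P \<in> borel_measurable M" by measurable
  have intP: "integrable M ?P"
    using integrable_cong_AE_imp[OF real_cond_exp_int(1)[OF int] meas] ae by auto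
  have "(\<integral>\<omega>. ?P \<omega> \<partial>M) = (\<integral>\<omega>. real_cond_exp M ?F (indicat_real ?A) \<omega> \<partial>M)"
    by (intro integral_cong_AE) (use ae meas in auto)
  also have "\<dots> = (\<integral>\<omega>. indicat_real ?A \<omega> \<partial>M)"
    by (rule real_cond_exp_int(2)[OF int])
  also have "\<dots> = measure M ?A" using A by simp
  finally have "(\<integral>\<omega>. ?P \<omega> \<partial>M) = measure M ?A" .
  moreover have "AE \<omega> in M. 0 \<le> ?P \<omega>"
    using W_nonneg by eventually_elim (intro prod_nonneg ballI poisson_mass_nonneg)
  ultimately show ?thesis
    using intP by (simp add: nn_integral_eq_integral emeasure_eq_measure)
qed

text \<open>Mixed form of the joint law: the variables in \<open>L\<close> are fixed to given values, those in \<open>K\<close> enter through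
  their generating functions. This generality lets the induction on \<open>K\<close> move one index at a time from \<open>K\<close>
  to \<open>L\<close>, by conditioning on the value of that variable; the joint law is the case of empty \<open>K\<close>.\<close>

lemma joint_transform:
  fixes s :: real
  assumes s: "0 \<le> s" "s \<le> 1"
    and K: "finite K" "K \<subseteq> {2..}"
  shows "finite L \<Longrightarrow> L \<subseteq> {2..} \<Longrightarrow> L \<inter> K = {} \<Longrightarrow>
    (\<integral>\<^sup>+\<omega>. indicator {\<omega> \<in> space M. \<forall>l\<in>L. X l \<omega> = k l} \<omega> * ennreal (\<Prod>l\<in>K. s ^ ((l - 1) * X l \<omega>)) \<partial>M) =
    (\<integral>\<^sup>+\<omega>. ennreal ((\<Prod>l\<in>L. poisson_mass p l (W \<omega>) (k l)) *
        (\<Prod>l\<in>K. exp (- (real l * pmf p l * W \<omega> * (1 - s ^ (l - 1)))))) \<partial>M)"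
  using K
proof (induction K arbitrary: L k rule: finite_induct)
  case empty
  then show ?case using joint_law[of L k] by simp
next
  case (insert m K)
  have m: "2 \<le> m" "m \<notin> L" and K: "K \<subseteq> {2..}" "finite K" and L: "L \<subseteq> {2..}" "finite L"
    using insert.prems insert.hyps by auto
  let ?B = "\<lambda>L k. {\<omega> \<in> space M. \<forall>l\<in>L. X l \<omega> = k l}"
  let ?Y = "\<lambda>\<omega>. ennreal (\<Prod>l\<in>K. s ^ ((l - 1) * X l \<omega>))"
  let ?E = "\<lambda>\<omega>. \<Prod>l\<in>K. exp (- (real l * pmf p l * W \<omega> * (1 - s ^ (l - 1))))"
  let ?P = "\<lambda>\<omega>. \<Prod>l\<in>L. poisson_mass p l (W \<omega>) (k l)"
  let ?u = "s ^ (m - 1)"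
  have u: "0 \<le> ?u" using s by simp
  have Ym [measurable]: "?Y \<in> borel_measurable M"
  proof -
    have [measurable]: "X l \<in> measurable M (count_space UNIV)" if "l \<in> K" for l
      using that K by (intro X_meas) auto
    show ?thesis by measurable
  qed
  have B [measurable]: "?B (insert m L) (k(m := j)) \<in> sets M" for j
    using m L by (intro level_sets) auto
  \<comment> \<open>Decompose by the value \<open>j\<close> of \<open>X m\<close>.\<close>
  have "(\<integral>\<^sup>+\<omega>. indicator (?B L k) \<omega> * ennreal (\<Prod>l\<in>insert m K. s ^ ((l - 1) * X l \<omega>)) \<partial>M) =
      (\<integral>\<^sup>+\<omega>. (\<Sum>j. indicator (?B (insert m L) (k(m := j))) \<omega> * ?Y \<omega> * ennreal (?u ^ j)) \<partial>M)"
  proof (rule nn_integral_cong)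
    fix \<omega> assume \<omega>: "\<omega> \<in> space M"
    have "(\<Sum>j. indicator (?B (insert m L) (k(m := j))) \<omega> * ?Y \<omega> * ennreal (?u ^ j)) =
        (\<Sum>j\<in>{X m \<omega>}. indicator (?B (insert m L) (k(m := j))) \<omega> * ?Y \<omega> * ennreal (?u ^ j))"
      by (rule suminf_finite) (auto simp: indicator_def)
    also have "\<dots> = indicator (?B L k) \<omega> * ennreal (\<Prod>l\<in>insert m K. s ^ ((l - 1) * X l \<omega>))"
    proof -
      have "\<omega> \<in> ?B (insert m L) (k(m := X m \<omega>)) \<longleftrightarrow> \<omega> \<in> ?B L k"
        using m \<omega> by auto
      then have 1: "indicator (?B (insert m L) (k(m := X m \<omega>))) \<omega> = (indicator (?B L k) \<omega> :: ennreal)"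
        unfolding indicator_def by simp
      have "(\<Prod>l\<in>insert m K. s ^ ((l - 1) * X l \<omega>)) = (\<Prod>l\<in>K. s ^ ((l - 1) * X l \<omega>)) * ?u ^ X m \<omega>"
        using insert.hyps by (simp add: power_mult)
      then have 2: "ennreal (\<Prod>l\<in>insert m K. s ^ ((l - 1) * X l \<omega>)) = ?Y \<omega> * ennreal (?u ^ X m \<omega>)"
        using u by (simp only: ennreal_mult'' zero_le_power)
      show ?thesis
        unfolding 2 by (simp only: sum.insert finite.emptyI empty_iff sum.empty 1 add_0_right mult.assoc not_False_eq_True)
    qed
    finally show "indicator (?B L k) \<omega> * ennreal (\<Prod>l\<in>insert m K. s ^ ((l - 1) * X l \<omega>)) =
        (\<Sum>j. indicator (?B (insert m L) (k(m := j))) \<omega> * ?Y \<omega> * ennreal (?u ^ j))" ..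
  qed
  also have "\<dots> = (\<Sum>j. (\<integral>\<^sup>+\<omega>. indicator (?B (insert m L) (k(m := j))) \<omega> * ?Y \<omega> \<partial>M) * ennreal (?u ^ j))"
  proof -
    have fm: "(\<lambda>\<omega>. indicator (?B (insert m L) (k(m := j))) \<omega> * ?Y \<omega>) \<in> borel_measurable M" for j
      by measurable
    show ?thesis
      by (simp only: nn_integral_suminf nn_integral_multc fm borel_measurable_times_ennreal borel_measurable_const)
  qed
  also have "\<dots> = (\<Sum>j. (\<integral>\<^sup>+\<omega>. ennreal (poisson_mass p m (W \<omega>) j * ?P \<omega> * ?E \<omega>) \<partial>M) * ennreal (?u ^ j))"
  proof -
    have "(\<integral>\<^sup>+\<omega>. indicator (?B (insert m L) (k(m := j))) \<omega> * ?Y \<omega> \<partial>M) =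
        (\<integral>\<^sup>+\<omega>. ennreal (poisson_mass p m (W \<omega>) j * ?P \<omega> * ?E \<omega>) \<partial>M)" for j
    proof -
      have "(\<integral>\<^sup>+\<omega>. indicator (?B (insert m L) (k(m := j))) \<omega> * ?Y \<omega> \<partial>M) =
        (\<integral>\<^sup>+\<omega>. ennreal ((\<Prod>l\<in>insert m L. poisson_mass p l (W \<omega>) ((k(m := j)) l)) * ?E \<omega>) \<partial>M)"
        using insert.prems insert.hyps by (intro insert.IH) auto
      also have "(\<lambda>\<omega>. \<Prod>l\<in>insert m L. poisson_mass p l (W \<omega>) ((k(m := j)) l)) =
          (\<lambda>\<omega>. poisson_mass p m (W \<omega>) j * ?P \<omega>)"
        using m L by (auto intro!: ext prod.cong arg_cong2[of _ _ _ _ "(*)"])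
      finally show ?thesis .
    qed
    then show ?thesis by simp
  qed
  also have "\<dots> = (\<integral>\<^sup>+\<omega>. (\<Sum>j. ennreal (poisson_mass p m (W \<omega>) j * ?P \<omega> * ?E \<omega>) * ennreal (?u ^ j)) \<partial>M)"
    by (simp add: nn_integral_suminf nn_integral_multc)
  also have "\<dots> = (\<integral>\<^sup>+\<omega>. ennreal (?P \<omega> *
        (\<Prod>l\<in>insert m K. exp (- (real l * pmf p l * W \<omega> * (1 - s ^ (l - 1)))))) \<partial>M)"
  proof (rule nn_integral_cong_AE, use W_nonneg in eventually_elim)
    fix \<omega> assume W: "0 \<le> W \<omega>"
    have E: "0 \<le> ?P \<omega> * ?E \<omega>"
      using W by (intro mult_nonneg_nonneg prod_nonneg ballI poisson_mass_nonneg) auto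
    have "(\<lambda>j. poisson_mass p m (W \<omega>) j * ?u ^ j * (?P \<omega> * ?E \<omega>)) sums
        (exp (- (real m * pmf p m * W \<omega> * (1 - ?u))) * (?P \<omega> * ?E \<omega>))"
      by (intro sums_mult2 poisson_mass_transform)
    then have "(\<Sum>j. ennreal (poisson_mass p m (W \<omega>) j * ?u ^ j * (?P \<omega> * ?E \<omega>))) =
        ennreal (exp (- (real m * pmf p m * W \<omega> * (1 - ?u))) * (?P \<omega> * ?E \<omega>))"
      using E u poisson_mass_nonneg[OF W, of p m]
      by (intro suminf_ennreal_eq) (auto intro!: mult_nonneg_nonneg)
    moreover have "ennreal (poisson_mass p m (W \<omega>) j * ?u ^ j * (?P \<omega> * ?E \<omega>)) =
        ennreal (poisson_mass p m (W \<omega>) j * ?P \<omega> * ?E \<omega>) * ennreal (?u ^ j)" for j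
      using u by (subst ennreal_mult''[symmetric]) (auto simp: mult_ac)
    ultimately show "(\<Sum>j. ennreal (poisson_mass p m (W \<omega>) j * ?P \<omega> * ?E \<omega>) * ennreal (?u ^ j)) =
      ennreal (?P \<omega> * (\<Prod>l\<in>insert m K. exp (- (real l * pmf p l * W \<omega> * (1 - s ^ (l - 1))))))"
      using insert.hyps by (simp add: mult_ac)
  qed
  finally show ?case .
qed

definition partial_total :: "nat \<Rightarrow> 'a \<Rightarrow> nat" where
  "partial_total N \<omega> = (\<Sum>l\<in>{2..<N}. (l - 1) * X l \<omega>)"

definition total :: "'a \<Rightarrow> ennreal" where
  "total \<omega> = (\<Sum>\<^sub>\<infinity>l\<in>{2..}. of_nat ((l - 1) * X l \<omega>))"

lemma partial_total_meas [measurable]: "partial_total N \<in> measurable M (count_space UNIV)"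
proof -
  have [measurable]: "X l \<in> measurable M (count_space UNIV)" if "l \<in> {2..<N}" for l
    using that by (intro X_meas) auto
  show ?thesis unfolding partial_total_def by measurable
qed

lemma partial_total_transform:
  fixes s :: real
  assumes s: "0 \<le> s" "s \<le> 1"
  shows "(\<integral>\<omega>. s ^ partial_total N \<omega> \<partial>M) =
    (\<integral>\<omega>. exp (- (W \<omega> * (\<Sum>l<N. real l * pmf p l * (1 - s ^ (l - 1))))) \<partial>M)"
proof -
  have "(\<integral>\<^sup>+\<omega>. ennreal (s ^ partial_total N \<omega>) \<partial>M) =
      (\<integral>\<^sup>+\<omega>. ennreal (\<Prod>l\<in>{2..<N}. exp (- (real l * pmf p l * W \<omega> * (1 - s ^ (l - 1))))) \<partial>M)"
    using joint_transform[OF s, of "{2..<N}" "{}"]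
    by (simp add: partial_total_def power_sum atLeastLessThan_def cong: nn_integral_cong_simp)
  also have "\<dots> = (\<integral>\<^sup>+\<omega>. ennreal (exp (- (W \<omega> * (\<Sum>l<N. real l * pmf p l * (1 - s ^ (l - 1)))))) \<partial>M)"
  proof (rule nn_integral_cong)
    fix \<omega>
    have "(\<Sum>l<N. real l * pmf p l * (1 - s ^ (l - 1))) = (\<Sum>l\<in>{2..<N}. real l * pmf p l * (1 - s ^ (l - 1)))"
    proof (rule sum.mono_neutral_right)
      show "\<forall>l\<in>{..<N} - {2..<N}. real l * pmf p l * (1 - s ^ (l - 1)) = 0"
      proof
        fix l assume "l \<in> {..<N} - {2..<N}"
        then have "l = 0 \<or> l = 1" by auto
        then show "real l * pmf p l * (1 - s ^ (l - 1)) = 0" by auto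
      qed
    qed auto
    then show "ennreal (\<Prod>l\<in>{2..<N}. exp (- (real l * pmf p l * W \<omega> * (1 - s ^ (l - 1))))) =
        ennreal (exp (- (W \<omega> * (\<Sum>l<N. real l * pmf p l * (1 - s ^ (l - 1))))))"
      by (simp add: exp_sum[symmetric] sum_negf sum_distrib_left mult_ac)
  qed
  finally show ?thesis
    using s by (subst (1 2) integral_eq_nn_integral) auto
qed

lemma partial_total_tendsto: "(\<lambda>N. of_nat (partial_total N \<omega>)) \<longlonglongrightarrow> total \<omega>"
proof -
  let ?g = "\<lambda>l. if 2 \<le> l then of_nat ((l - 1) * X l \<omega>) else (0::ennreal)"
  have "(?g has_sum infsum ?g UNIV) UNIV"
    by (intro has_sum_infsum nonneg_summable_on_complete) auto
  then have "?g sums infsum ?g UNIV" by (rule has_sum_imp_sums)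
  moreover have "infsum ?g UNIV = total \<omega>"
    unfolding total_def by (intro infsum_cong_neutral) auto
  moreover have "(\<lambda>N. \<Sum>l<N. ?g l) = (\<lambda>N. of_nat (partial_total N \<omega>))"
  proof
    fix N
    have "(\<Sum>l<N. ?g l) = (\<Sum>l\<in>{2..<N}. of_nat ((l - 1) * X l \<omega>))"
      by (rule sum.mono_neutral_cong_right) auto
    then show "(\<Sum>l<N. ?g l) = of_nat (partial_total N \<omega>)"
      by (simp add: partial_total_def)
  qed
  ultimately show ?thesis unfolding sums_def by simp
qed

lemma total_meas [measurable]: "total \<in> borel_measurable M"
proof (rule measurable_cong[THEN iffD2])
  show "(\<lambda>\<omega>. liminf (\<lambda>N. of_nat (partial_total N \<omega>) :: ennreal)) \<in> borel_measurable M"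
    by measurable
  show "total \<omega> = liminf (\<lambda>N. of_nat (partial_total N \<omega>))" for \<omega>
    using lim_imp_Liminf[OF _ partial_total_tendsto] by simp
qed

lemma mono_partial_total: "mono (\<lambda>N. partial_total N \<omega>)"
  unfolding partial_total_def by (intro monoI sum_mono2) auto

text \<open>The partial totals are increasing natural numbers. If they are bounded, they are eventually constant
  and equal to the total; otherwise the total is infinite and both sides vanish, because \<open>s < 1\<close>.\<close>

lemma power_partial_total_tendsto:
  fixes s :: real
  assumes s: "0 \<le> s" "s < 1"
  shows "(\<lambda>N. s ^ partial_total N \<omega>) \<longlonglongrightarrow> (\<Sum>k. s ^ k * of_bool (total \<omega> = of_nat k))"
proof (cases "\<exists>K. \<forall>N. partial_total N \<omega> \<le> K")
  case True
  then have fin: "finite (range (\<lambda>N. partial_total N \<omega>))"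
    by (auto intro: finite_subset[of _ "{.._}"])
  define m where "m = Max (range (\<lambda>N. partial_total N \<omega>))"
  have "m \<in> range (\<lambda>N. partial_total N \<omega>)"
    unfolding m_def using fin by (intro Max_in) auto
  then obtain N0 where N0: "partial_total N0 \<omega> = m" by auto
  have ev: "\<forall>\<^sub>F N in sequentially. partial_total N \<omega> = m"
    using eventually_ge_at_top[of N0]
  proof eventually_elim
    case (elim N)
    have "partial_total N \<omega> \<le> m"
      unfolding m_def using fin by (intro Max_ge) auto
    with monoD[OF mono_partial_total elim, of \<omega>] N0 show ?case by simp
  qed
  have "(\<lambda>N. of_nat (partial_total N \<omega>) :: ennreal) \<longlonglongrightarrow> of_nat m"
    by (rule tendsto_eventually) (use ev in eventually_elim, simp)
  then have tot: "total \<omega> = of_nat m"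
    using partial_total_tendsto[of \<omega>] LIMSEQ_unique by blast
  have "(\<Sum>k. s ^ k * of_bool (total \<omega> = of_nat k)) = (\<Sum>k\<in>{m}. s ^ k * of_bool (total \<omega> = of_nat k))"
    by (rule suminf_finite) (auto simp: tot)
  moreover have "(\<lambda>N. s ^ partial_total N \<omega>) \<longlonglongrightarrow> s ^ m"
    by (rule tendsto_eventually) (use ev in eventually_elim, simp)
  ultimately show ?thesis by (simp add: tot)
next
  case False
  have "filterlim (\<lambda>N. partial_total N \<omega>) at_top sequentially"
    unfolding filterlim_at_top
  proof
    fix K
    obtain N0 where "K \<le> partial_total N0 \<omega>"
      using False by (meson nat_le_linear)
    then show "\<forall>\<^sub>F N in sequentially. K \<le> partial_total N \<omega>"
      using monoD[OF mono_partial_total, of N0 _ \<omega>] unfolding eventually_sequentially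
      by (meson order_trans)
  qed
  then have "(\<lambda>N. s ^ partial_total N \<omega>) \<longlonglongrightarrow> 0"
    using filterlim_compose[OF LIMSEQ_realpow_zero[OF s]] by blast
  moreover have "total \<omega> \<noteq> of_nat k" for k
  proof
    assume tot: "total \<omega> = of_nat k"
    have "partial_total N \<omega> \<le> k" for N
    proof -
      have "(of_nat (partial_total N \<omega>) :: ennreal) \<le> total \<omega>"
        using monoD[OF mono_partial_total]
        by (intro incseq_le[OF _ partial_total_tendsto]) (auto intro!: monoI)
      then show ?thesis by (simp add: tot)
    qed
    then show False using False by blast
  qed
  ultimately show ?thesis by simp
qed

lemma limit_prob_eq: "limit_prob M X k = prob {\<omega> \<in> space M. total \<omega> = of_nat k}"
  by (simp add: limit_prob_def total_def)

lemma total_level_sets: "{\<omega> \<in> space M. total \<omega> = of_nat k} \<in> sets M"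
  by measurable

lemma limit_prob_nonneg: "0 \<le> limit_prob M X k"
  by (simp add: limit_prob_eq)

lemma summable_limit_prob: "summable (limit_prob M X)"
  and suminf_limit_prob_le: "(\<Sum>k. limit_prob M X k) \<le> 1"
proof -
  have "(\<lambda>k. prob {\<omega> \<in> space M. total \<omega> = of_nat k}) sums prob (\<Union>k. {\<omega> \<in> space M. total \<omega> = of_nat k})"
    using total_level_sets by (intro finite_measure_UNION) (auto simp: disjoint_family_on_def)
  then have "limit_prob M X sums prob (\<Union>k. {\<omega> \<in> space M. total \<omega> = of_nat k})"
    by (simp add: limit_prob_eq[abs_def])
  then show "summable (limit_prob M X)" "(\<Sum>k. limit_prob M X k) \<le> 1"
    by (auto simp: sums_iff)
qed

text \<open>The generating functions of the partial totals converge by dominated convergence on both sides. An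
  infinite total would contribute nothing on the left, so this identity alone does not show that the
  limit law has mass 1.\<close>

lemma limit_transform:
  fixes s :: real
  assumes s: "0 \<le> s" "s < 1"
  shows "(\<Sum>k. limit_prob M X k * s ^ k) = (\<integral>\<omega>. exp (- (W \<omega> * mark_exponent p s)) \<partial>M)"
proof -
  have s1: "s \<le> 1" using s by simp
  let ?A = "\<lambda>k. {\<omega> \<in> space M. total \<omega> = of_nat k}"
  let ?Y = "\<lambda>\<omega>. \<Sum>k. s ^ k * indicat_real (?A k) \<omega>"
  let ?c = "\<lambda>N. \<Sum>l<N. real l * pmf p l * (1 - s ^ (l - 1))"
  have A: "?A k \<in> sets M" for k by (rule total_level_sets)
  have "(\<lambda>N. \<integral>\<omega>. s ^ partial_total N \<omega> \<partial>M) \<longlonglongrightarrow> (\<integral>\<omega>. ?Y \<omega> \<partial>M)"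
  proof (rule integral_dominated_convergence[where w = "\<lambda>_. 1"])
    show "AE \<omega> in M. (\<lambda>N. s ^ partial_total N \<omega>) \<longlonglongrightarrow> ?Y \<omega>"
    proof (rule AE_I2)
      fix \<omega> assume "\<omega> \<in> space M"
      then have "?Y \<omega> = (\<Sum>k. s ^ k * of_bool (total \<omega> = of_nat k))"
        by (simp add: indicator_def)
      with power_partial_total_tendsto[OF s, of \<omega>]
      show "(\<lambda>N. s ^ partial_total N \<omega>) \<longlonglongrightarrow> ?Y \<omega>" by simp
    qed
    show "?Y \<in> borel_measurable M"
      using A by measurable
    show "AE \<omega> in M. norm (s ^ partial_total N \<omega>) \<le> 1" for N
      using s by (auto simp: power_le_one)
  qed auto
  moreover have "(\<lambda>N. \<integral>\<omega>. exp (- (W \<omega> * ?c N)) \<partial>M) \<longlonglongrightarrow> (\<integral>\<omega>. exp (- (W \<omega> * mark_exponent p s)) \<partial>M)"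
  proof (rule integral_dominated_convergence[where w = "\<lambda>_. 1"])
    have "?c \<longlonglongrightarrow> mark_exponent p s"
      unfolding mark_exponent_def
      using summable_LIMSEQ[OF summable_mark_exponent[OF p_mean s(1) s1]] .
    then show "AE \<omega> in M. (\<lambda>N. exp (- (W \<omega> * ?c N))) \<longlonglongrightarrow> exp (- (W \<omega> * mark_exponent p s))"
      by (intro AE_I2 tendsto_intros)
    show "AE \<omega> in M. norm (exp (- (W \<omega> * ?c N))) \<le> 1" for N
      using W_nonneg
    proof eventually_elim
      case (elim \<omega>)
      have "0 \<le> ?c N"
        using s by (intro sum_nonneg mult_nonneg_nonneg) (auto simp: power_le_one)
      with elim show ?case by simp
    qed
  qed auto
  ultimately have "(\<integral>\<omega>. ?Y \<omega> \<partial>M) = (\<integral>\<omega>. exp (- (W \<omega> * mark_exponent p s)) \<partial>M)"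
    unfolding partial_total_transform[OF s(1) s1] by (rule LIMSEQ_unique)
  moreover have "(\<integral>\<omega>. ?Y \<omega> \<partial>M) = (\<Sum>k. \<integral>\<omega>. s ^ k * indicat_real (?A k) \<omega> \<partial>M)"
  proof (rule integral_suminf)
    have geo: "summable (\<lambda>k. s ^ k)" using s by (simp add: summable_geometric)
    show "integrable M (\<lambda>\<omega>. s ^ k * indicat_real (?A k) \<omega>)" for k
      using A by (auto simp: integrable_indicator_iff less_top[symmetric])
    show "AE \<omega> in M. summable (\<lambda>k. norm (s ^ k * indicat_real (?A k) \<omega>))"
      using s by (intro AE_I2 summable_comparison_test'[OF geo, of 0]) (auto simp: indicator_def)
    show "summable (\<lambda>k. \<integral>\<omega>. norm (s ^ k * indicat_real (?A k) \<omega>) \<partial>M)"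
      using s A by (intro summable_comparison_test'[OF geo, of 0]) (auto simp: abs_mult mult_left_le)
  qed
  ultimately show ?thesis
    using A by (simp add: limit_prob_eq mult.commute)
qed

text \<open>The mass is at least the value of the generating function at \<open>s\<close>, which is at least
  \<open>1 - (1 - s) * E W * (\<Sum>k. k\<^sup>2 * pmf p k)\<close>; let \<open>s\<close> tend to 1.\<close>

lemma limit_prob_sums: "limit_prob M X sums 1"
proof -
  let ?C = "(\<integral>\<omega>. W \<omega> \<partial>M) * (\<Sum>k. real k ^ 2 * pmf p k)"
  have "1 - (1 - s) * ?C \<le> (\<Sum>k. limit_prob M X k)" if s: "0 \<le> s" "s < 1" for s :: real
  proof -
    have s1: "s \<le> 1" using s by simp
    have W0: "0 \<le> (\<integral>\<omega>. W \<omega> \<partial>M)" using W_nonneg by (rule integral_nonneg_AE)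
    have "1 - (1 - s) * ?C \<le> 1 - (\<integral>\<omega>. W \<omega> \<partial>M) * mark_exponent p s"
      using mult_left_mono[OF mark_exponent_le[OF p_mean p_square s(1) s1] W0] by (simp add: mult_ac)
    also have "\<dots> = (\<integral>\<omega>. 1 - W \<omega> * mark_exponent p s \<partial>M)"
      using W_int by (simp add: prob_space)
    also have "\<dots> \<le> (\<integral>\<omega>. exp (- (W \<omega> * mark_exponent p s)) \<partial>M)"
    proof (rule integral_mono)
      show "integrable M (\<lambda>\<omega>. exp (- (W \<omega> * mark_exponent p s)))"
      proof (rule integrable_const_bound[where B = 1])
        show "AE \<omega> in M. norm (exp (- (W \<omega> * mark_exponent p s))) \<le> 1"
          using W_nonneg by eventually_elim (simp add: mark_exponent_nonneg[OF p_mean s(1) s1])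
      qed measurable
      show "1 - W \<omega> * mark_exponent p s \<le> exp (- (W \<omega> * mark_exponent p s))" for \<omega>
        using exp_ge_add_one_self[of "- (W \<omega> * mark_exponent p s)"] by simp
    qed (use W_int in auto)
    also have "\<dots> = (\<Sum>k. limit_prob M X k * s ^ k)"
      by (rule limit_transform[OF s, symmetric])
    also have "\<dots> \<le> (\<Sum>k. limit_prob M X k)"
    proof (rule suminf_le)
      show le: "limit_prob M X k * s ^ k \<le> limit_prob M X k" for k
        using s limit_prob_nonneg by (intro mult_left_le) (auto simp: power_le_one)
      show "summable (\<lambda>k. limit_prob M X k * s ^ k)"
        using s le limit_prob_nonneg
        by (intro summable_comparison_test'[OF summable_limit_prob, of 0]) auto
    qed (rule summable_limit_prob)
    finally show ?thesis .
  qed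
  then have "\<forall>\<^sub>F s in at_left 1. 1 - (1 - s) * ?C \<le> (\<Sum>k. limit_prob M X k)"
    using eventually_at_left_real[of 0 1] by (auto elim: eventually_mono)
  moreover have "((\<lambda>s. 1 - (1 - s) * ?C) \<longlongrightarrow> 1 - (1 - 1) * ?C) (at_left 1)"
    by (intro tendsto_intros)
  ultimately have "1 - (1 - 1) * ?C \<le> (\<Sum>k. limit_prob M X k)"
    by (intro tendsto_upperbound[where F = "at_left (1::real)"]) auto
  then show ?thesis
    using suminf_limit_prob_le summable_limit_prob by (simp add: sums_iff)
qed

end

section \<open>From generating functions to probabilities\<close>

text \<open>In the difference of the generating functions the terms below \<open>k\<close> are controlled by the earlier
  coefficients, and the terms above \<open>k\<close> form two numbers between 0 and \<open>s ^ Suc k\<close>, because each sequence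
  has mass 1. Division by \<open>s ^ k\<close> leaves the error \<open>s\<close>, which can be made small.\<close>

lemma coefficient_diff_le:
  fixes a b :: "nat \<Rightarrow> real"
  assumes a: "\<And>k. 0 \<le> a k" "a sums 1" and b: "\<And>k. 0 \<le> b k" "b sums 1"
    and s: "0 < s" "s < 1"
  shows "\<bar>a k - b k\<bar> \<le>
    (\<bar>(\<Sum>j. a j * s ^ j) - (\<Sum>j. b j * s ^ j)\<bar> + (\<Sum>j<k. \<bar>a j - b j\<bar>)) / s ^ k + s"
proof -
  have tail: "summable (\<lambda>j. c j * s ^ j)"
      "0 \<le> (\<Sum>j. c j * s ^ j) - (\<Sum>j<Suc k. c j * s ^ j)"
      "(\<Sum>j. c j * s ^ j) - (\<Sum>j<Suc k. c j * s ^ j) \<le> s ^ Suc k"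
    if c: "\<And>k. 0 \<le> c k" "c sums 1" for c :: "nat \<Rightarrow> real"
  proof -
    have sc: "summable c" using c(2) by (rule sums_summable)
    show sum: "summable (\<lambda>j. c j * s ^ j)"
      using c s by (intro summable_comparison_test'[OF sc, of 0]) (auto intro!: mult_left_le power_le_one)
    have split: "(\<Sum>j. c j * s ^ j) - (\<Sum>j<Suc k. c j * s ^ j) = (\<Sum>j. c (j + Suc k) * s ^ (j + Suc k))"
      using suminf_split_initial_segment[OF sum, of "Suc k"] by simp
    have sum': "summable (\<lambda>j. c (j + Suc k) * s ^ (j + Suc k))"
      using sum by (rule summable_ignore_initial_segment)
    show "0 \<le> (\<Sum>j. c j * s ^ j) - (\<Sum>j<Suc k. c j * s ^ j)"
      unfolding split using c s by (intro suminf_nonneg sum') auto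
    have sc': "summable (\<lambda>j. c (j + Suc k))"
      using sc by (rule summable_ignore_initial_segment)
    have "(\<Sum>j. c (j + Suc k) * s ^ (j + Suc k)) \<le> (\<Sum>j. c (j + Suc k) * s ^ Suc k)"
      using c s by (intro suminf_le sum' summable_mult2 sc' mult_left_mono power_decreasing) auto
    also have "\<dots> = (\<Sum>j. c (j + Suc k)) * s ^ Suc k"
      by (rule suminf_mult2[OF sc', symmetric])
    also have "(\<Sum>j. c (j + Suc k)) \<le> 1"
      using suminf_split_initial_segment[OF sc, of "Suc k"] c sum_nonneg[of "{..<Suc k}" c]
      by (simp add: sums_iff)
    then have "(\<Sum>j. c (j + Suc k)) * s ^ Suc k \<le> 1 * s ^ Suc k"
      using s by (intro mult_right_mono) auto
    finally show "(\<Sum>j. c j * s ^ j) - (\<Sum>j<Suc k. c j * s ^ j) \<le> s ^ Suc k"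
      unfolding split by simp
  qed
  let ?D = "\<bar>(\<Sum>j. a j * s ^ j) - (\<Sum>j. b j * s ^ j)\<bar>"
  have "\<bar>\<Sum>j<k. (a j - b j) * s ^ j\<bar> \<le> (\<Sum>j<k. \<bar>a j - b j\<bar>)"
  proof (rule order_trans[OF sum_abs sum_mono])
    fix j
    show "\<bar>(a j - b j) * s ^ j\<bar> \<le> \<bar>a j - b j\<bar>"
      using s by (auto simp: abs_mult intro!: mult_left_le power_le_one)
  qed
  moreover have "(\<Sum>j<k. (a j - b j) * s ^ j) = (\<Sum>j<k. a j * s ^ j) - (\<Sum>j<k. b j * s ^ j)"
    by (simp add: sum_subtractf left_diff_distrib)
  moreover have "\<bar>(a k - b k) * s ^ k\<bar> = \<bar>a k - b k\<bar> * s ^ k"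
    using s by (simp add: abs_mult)
  moreover have "(a k - b k) * s ^ k = a k * s ^ k - b k * s ^ k"
    by (rule left_diff_distrib)
  ultimately have "\<bar>a k - b k\<bar> * s ^ k \<le> ?D + (\<Sum>j<k. \<bar>a j - b j\<bar>) + s ^ Suc k"
    using tail(2,3)[of a, OF a] tail(2,3)[of b, OF b] by simp
  then have "\<bar>a k - b k\<bar> \<le> (?D + (\<Sum>j<k. \<bar>a j - b j\<bar>) + s ^ Suc k) / s ^ k"
    using s by (simp add: pos_le_divide_eq)
  also have "\<dots> = (?D + (\<Sum>j<k. \<bar>a j - b j\<bar>)) / s ^ k + s"
    using s by (simp add: add_divide_distrib)
  finally show ?thesis .
qed

text \<open>Scheffe's argument: for equal masses the distance is twice the sum of the positive parts of
  \<open>b k - a k\<close>, and these are at most \<open>b k\<close>, so only the tail of the fixed law \<open>b\<close> occurs.\<close>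

lemma l1_distance_le:
  fixes a b :: "nat \<Rightarrow> real"
  assumes a: "\<And>k. 0 \<le> a k" "a sums 1" and b: "\<And>k. 0 \<le> b k" "b sums 1"
  shows "(\<Sum>k. \<bar>a k - b k\<bar>) \<le> 2 * (\<Sum>k<K. \<bar>a k - b k\<bar>) + 2 * (\<Sum>k. b (k + K))"
proof -
  have sa: "summable a" and sb: "summable b"
    using a(2) b(2) by (auto intro: sums_summable)
  define m where "m k = max 0 (b k - a k)" for k
  have m: "0 \<le> m k" "m k \<le> b k" "m k \<le> \<bar>a k - b k\<bar>" for k
    using a(1)[of k] b(1)[of k] by (auto simp: m_def)
  have sm: "summable m"
    using m by (intro summable_comparison_test'[OF sb, of 0]) auto
  have "\<bar>a k - b k\<bar> = a k - b k + 2 * m k" for k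
    by (simp add: m_def max_def abs_if)
  then have "(\<Sum>k. \<bar>a k - b k\<bar>) = (\<Sum>k. a k - b k + 2 * m k)" by simp
  also have "\<dots> = (\<Sum>k. a k - b k) + (\<Sum>k. 2 * m k)"
    by (intro suminf_add[symmetric] summable_diff summable_mult sa sb sm)
  also have "\<dots> = 2 * (\<Sum>k. m k)"
    using a(2) b(2) by (simp add: suminf_diff[symmetric] sa sb suminf_mult sm sums_iff)
  also have "(\<Sum>k. m k) = (\<Sum>k. m (k + K)) + (\<Sum>k<K. m k)"
    by (rule suminf_split_initial_segment[OF sm])
  also have "(\<Sum>k. m (k + K)) \<le> (\<Sum>k. b (k + K))"
    using m by (intro suminf_le summable_ignore_initial_segment sm sb) auto
  also have "(\<Sum>k<K. m k) \<le> (\<Sum>k<K. \<bar>a k - b k\<bar>)"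
    using m by (intro sum_mono) auto
  finally show ?thesis by simp
qed

text \<open>The parameter \<open>s\<close> is chosen below the target accuracy before \<open>n\<close> tends to infinity; strong induction
  takes care of the earlier coefficients.\<close>

lemma coefficient_errors_vanish:
  fixes d e :: "_ \<Rightarrow> nat \<Rightarrow> real"
  assumes nonneg: "\<And>k n. 0 \<le> d k n"
    and e: "\<And>s::real. 0 < s \<Longrightarrow> s < 1 \<Longrightarrow> e s \<longlonglongrightarrow> 0"
    and d: "\<And>k s. 0 < s \<Longrightarrow> s < 1 \<Longrightarrow>
      \<forall>\<^sub>F n in sequentially. d k n \<le> (e s n + (\<Sum>j<k. d j n)) / s ^ k + s"
  shows "d k \<longlonglongrightarrow> 0"
proof (induction k rule: less_induct)
  case (less k)
  show ?case
  proof (rule tendstoI)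
    fix \<delta> :: real assume \<delta>: "0 < \<delta>"
    define s where "s = min (1/2) (\<delta> / 2)"
    have s: "0 < s" "s < 1" "s < \<delta>" using \<delta> by (auto simp: s_def)
    have "(\<lambda>n. (e s n + (\<Sum>j<k. d j n)) / s ^ k + s) \<longlonglongrightarrow> (0 + (\<Sum>j<k. 0)) / s ^ k + s"
      using s by (intro tendsto_intros e less) auto
    then have "\<forall>\<^sub>F n in sequentially. (e s n + (\<Sum>j<k. d j n)) / s ^ k + s < \<delta>"
      using s by (intro order_tendstoD) auto
    then show "\<forall>\<^sub>F n in sequentially. dist (d k n) 0 < \<delta>"
      using d[OF s(1,2), of k] by eventually_elim (use nonneg in auto)
  qed
qed

section \<open>Convergence of the degree distribution\<close>

lemma degree_prop_nonneg: "0 \<le> degree_prop n \<omega> k"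
  by (simp add: degree_prop_def sum_nonneg)

lemma degree_prop_transform:
  "(\<lambda>k. degree_prop n \<omega> k * s ^ k) sums ((\<Sum>i\<in>{1..n}. s ^ degree n \<omega> i) / real n)"
proof -
  have "(\<lambda>k. of_bool (degree n \<omega> i = k) * s ^ k) sums s ^ degree n \<omega> i" for i
    using sums_single[of "degree n \<omega> i" "\<lambda>k. s ^ k"]
    by (rule back_subst[where P = "\<lambda>f. f sums _"]) auto
  then have "(\<lambda>k. (\<Sum>i\<in>{1..n}. of_bool (degree n \<omega> i = k) * s ^ k) / real n) sums
      ((\<Sum>i\<in>{1..n}. s ^ degree n \<omega> i) / real n)"
    by (intro sums_divide sums_sum)
  then show ?thesis
    by (simp add: degree_prop_def sum_distrib_right)
qed

lemma degree_prop_sums: "1 \<le> n \<Longrightarrow> degree_prop n \<omega> sums 1"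
  using degree_prop_transform[of n \<omega> 1] by simp

context inhomogeneous_groups
begin

text \<open>The three terms are the standard deviation of the generating function, the defects in its mean, and
  the distance from \<open>g\<close> of the average over the vertices that weak convergence controls.\<close>

lemma degree_transform_deviation:
  fixes s g :: real
  assumes n: "1 \<le> n" and s: "0 \<le> s" "s \<le> 1" and p2: "summable (\<lambda>k. real k ^ 2 * pmf p k)"
  shows "measure_pmf.expectation (group_pmf p n w) (\<lambda>\<omega>. \<bar>(\<Sum>k. degree_prop n \<omega> k * s ^ k) - g\<bar>) \<le>
    sqrt (1 / real n + (L / real n) * (\<Sum>k. real k ^ 2 * pmf p k) / real n) +
    (\<Sum>l. (\<Sum>i\<in>{1..n}. odds_defect p n w i l) / real n) +
    \<bar>(\<Sum>i\<in>{1..n}. exp (- (w i * mark_exponent p s))) / real n - g\<bar>"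
proof -
  let ?E = "measure_pmf.expectation (group_pmf p n w)"
  let ?G = "\<lambda>\<omega>. \<Sum>i\<in>{1..n}. s ^ degree n \<omega> i"
  let ?e = "\<Sum>i\<in>{1..n}. exp (- (w i * mark_exponent p s))"
  let ?C = "\<Sum>k. real k ^ 2 * pmf p k"
  have n0: "0 < real n" using n by simp
  have "?E (\<lambda>\<omega>. \<bar>?G \<omega> - ?E ?G\<bar>) \<le> sqrt (?E (\<lambda>\<omega>. (?G \<omega> - ?E ?G)\<^sup>2))"
  proof (rule real_le_rsqrt)
    \<comment> \<open>The variance of the absolute deviation is nonnegative.\<close>
    show "(?E (\<lambda>\<omega>. \<bar>?G \<omega> - ?E ?G\<bar>))\<^sup>2 \<le> ?E (\<lambda>\<omega>. (?G \<omega> - ?E ?G)\<^sup>2)"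
      using measure_pmf.variance_positive[of "group_pmf p n w" "\<lambda>\<omega>. \<bar>?G \<omega> - ?E ?G\<bar>"] by (subst (asm) measure_pmf.variance_eq) auto
  qed
  also have "?E (\<lambda>\<omega>. (?G \<omega> - ?E ?G)\<^sup>2) = ?E (\<lambda>\<omega>. (?G \<omega>)\<^sup>2) - (?E ?G)\<^sup>2"
    by (rule measure_pmf.variance_eq) auto
  also have "sqrt \<dots> \<le> sqrt (real n + L * ?C)"
    using variance_degree_transform[OF s p2] by simp
  finally have dev: "?E (\<lambda>\<omega>. \<bar>?G \<omega> - ?E ?G\<bar>) \<le> sqrt (real n + L * ?C)" .
  have "sqrt (real n + L * ?C) / real n = sqrt ((real n + L * ?C) / (real n)\<^sup>2)"
    using n0 by (simp add: real_sqrt_divide)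
  also have "(real n + L * ?C) / (real n)\<^sup>2 = 1 / real n + (L / real n) * ?C / real n"
    using n0 by (simp add: field_simps power2_eq_square)
  finally have root: "sqrt (real n + L * ?C) / real n = sqrt (1 / real n + (L / real n) * ?C / real n)" .
  have defect: "summable (\<lambda>l. \<Sum>i\<in>{1..n}. odds_defect p n w i l)"
    using summable_odds_defect by (intro summable_sum) auto
  have triangle: "\<bar>x / real n - g\<bar> \<le> \<bar>x - y\<bar> / real n + \<bar>y - z\<bar> / real n + \<bar>z / real n - g\<bar>"
    for x y z :: real
  proof -
    have "x / real n - g = (x - y) / real n + (y - z) / real n + (z / real n - g)"
      by (simp add: diff_divide_distrib)
    moreover have "\<bar>x - y\<bar> / real n = \<bar>(x - y) / real n\<bar>" "\<bar>y - z\<bar> / real n = \<bar>(y - z) / real n\<bar>"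
      by simp_all
    ultimately show ?thesis by linarith
  qed
  have "?E (\<lambda>\<omega>. \<bar>(\<Sum>k. degree_prop n \<omega> k * s ^ k) - g\<bar>) = ?E (\<lambda>\<omega>. \<bar>?G \<omega> / real n - g\<bar>)"
    using degree_prop_transform by (simp add: sums_iff)
  also have "\<dots> \<le> ?E (\<lambda>\<omega>. \<bar>?G \<omega> - ?E ?G\<bar> / real n + \<bar>?E ?G - ?e\<bar> / real n + \<bar>?e / real n - g\<bar>)"
  proof (rule integral_mono)
    show "\<bar>?G \<omega> / real n - g\<bar> \<le> \<bar>?G \<omega> - ?E ?G\<bar> / real n + \<bar>?E ?G - ?e\<bar> / real n + \<bar>?e / real n - g\<bar>" for \<omega>
      by (rule triangle)
  qed auto
  also have "\<dots> = ?E (\<lambda>\<omega>. \<bar>?G \<omega> - ?E ?G\<bar>) / real n + \<bar>?E ?G - ?e\<bar> / real n + \<bar>?e / real n - g\<bar>"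
    by (simp add: measure_pmf.prob_space)
  also have "\<dots> \<le> sqrt (real n + L * ?C) / real n +
      (\<Sum>l. \<Sum>i\<in>{1..n}. odds_defect p n w i l) / real n + \<bar>?e / real n - g\<bar>"
    using dev mean_degree_transform[OF s] by (intro add_mono divide_right_mono) auto
  also have "(\<Sum>l. \<Sum>i\<in>{1..n}. odds_defect p n w i l) / real n =
      (\<Sum>l. (\<Sum>i\<in>{1..n}. odds_defect p n w i l) / real n)"
    by (rule suminf_divide[OF defect, symmetric])
  finally show ?thesis unfolding root .
qed

end

text \<open>For each group size the mean defect is of order \<open>1 / n\<close>; Tannery's theorem exchanges the limit with the
  sum over the sizes, since the mean defect of size \<open>l\<close> is at most \<open>l * pmf p l\<close> times the mean weight.\<close>

lemma mean_odds_defect_tendsto: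
  fixes m v :: real
  assumes groups: "\<And>n. 1 \<le> n \<Longrightarrow> inhomogeneous_groups p n (w n)"
    and m: "0 < m" "(\<lambda>n. total_weight n (w n) / real n) \<longlonglongrightarrow> m"
    and v: "(\<lambda>n. (\<Sum>i\<in>{1..n}. (w n i)\<^sup>2) / real n) \<longlonglongrightarrow> v"
  shows "(\<lambda>n. \<Sum>l. (\<Sum>i\<in>{1..n}. odds_defect p n (w n) i l) / real n) \<longlonglongrightarrow> 0"
proof -
  let ?a = "\<lambda>l n. (\<Sum>i\<in>{1..n}. odds_defect p n (w n) i l) / real n"
  let ?L = "\<lambda>n. total_weight n (w n)" and ?S = "\<lambda>n. \<Sum>i\<in>{1..n}. (w n i)\<^sup>2"
  have p: "summable (\<lambda>k. real k * pmf p k)"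
    using inhomogeneous_groups.p_mean[OF groups[of 1]] by simp
  have ev: "\<forall>\<^sub>F n in sequentially. 1 \<le> n" by (rule eventually_ge_at_top)
  have ratio: "(\<lambda>n. ?S n / ?L n) \<longlonglongrightarrow> v / m"
  proof (rule Lim_transform_eventually)
    show "(\<lambda>n. (?S n / real n) / (?L n / real n)) \<longlonglongrightarrow> v / m"
      using m by (intro tendsto_divide v) auto
    show "\<forall>\<^sub>F n in sequentially. (?S n / real n) / (?L n / real n) = ?S n / ?L n"
      using ev by eventually_elim auto
  qed
  have lim: "?a l \<longlonglongrightarrow> 0" for l
  proof (rule tendsto_sandwich[OF _ _ tendsto_const])
    show "\<forall>\<^sub>F n in sequentially. 0 \<le> ?a l n"
      using ev by eventually_elim (intro divide_nonneg_nonneg inhomogeneous_groups.sum_odds_defect_bounds groups, auto)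
    let ?k1 = "real l * pmf p l * (real (l - 1) * real l / 2)"
    let ?k2 = "real l * (group_factor p l)\<^sup>2"
    let ?b = "\<lambda>n. (?k1 * (?S n / ?L n) + ?k2 * (?S n / ?L n)\<^sup>2) * (1 / real n)"
    show "\<forall>\<^sub>F n in sequentially. ?a l n \<le> ?b n"
      using ev
    proof eventually_elim
      case (elim n)
      interpret inhomogeneous_groups p n "w n" by (rule groups[OF elim])
      show ?case
      proof (cases "2 \<le> l")
        case True
        then obtain j where j: "l = j + 2" by (metis add.commute le_Suc_ex)
        show ?thesis
          using divide_right_mono[OF sum_odds_defect_le[of j], of "real n"] by (simp add: j)
      next
        case False
        then have "(\<Sum>i\<in>{1..n}. odds_defect p n (w n) i l) \<le> 0"
          using sum_odds_defect_bounds(2)[of l] by (simp add: pmf_small)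
        moreover have "0 \<le> ?b n"
          using total_pos by (intro mult_nonneg_nonneg add_nonneg_nonneg divide_nonneg_nonneg sum_nonneg) auto
        ultimately show ?thesis
          by (meson divide_nonpos_nonneg of_nat_0_le_iff order_trans)
      qed
    qed
    have "?b \<longlonglongrightarrow> (?k1 * (v / m) + ?k2 * (v / m)\<^sup>2) * 0"
      by (intro tendsto_intros ratio lim_1_over_n)
    then show "?b \<longlonglongrightarrow> 0" by simp
  qed
  have bound: "\<forall>\<^sub>F (l, n) in at_top \<times>\<^sub>F sequentially. norm (?a l n) \<le> real l * pmf p l * (m + 1)"
  proof -
    have "\<forall>\<^sub>F n in sequentially. ?L n / real n < m + 1"
      using m by (intro order_tendstoD) auto
    with ev have "\<forall>\<^sub>F n in sequentially. \<forall>l. norm (?a l n) \<le> real l * pmf p l * (m + 1)"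
    proof eventually_elim
      case (elim n)
      interpret inhomogeneous_groups p n "w n" by (rule groups[OF elim(1)])
      show ?case
      proof
        fix l
        have "?a l n \<le> real l * pmf p l * ?L n / real n"
          by (intro divide_right_mono sum_odds_defect_bounds) auto
        also have "\<dots> = real l * pmf p l * (?L n / real n)" by simp
        also have "\<dots> \<le> real l * pmf p l * (m + 1)"
          using elim by (intro mult_left_mono) auto
        finally show "norm (?a l n) \<le> real l * pmf p l * (m + 1)"
          using sum_odds_defect_bounds(1)[of l] by simp
      qed
    qed
    then show ?thesis
      unfolding eventually_prod_filter by (intro exI[of _ "\<lambda>_. True"] exI[of _ "\<lambda>n. \<forall>l. norm (?a l n) \<le> real l * pmf p l * (m + 1)"]) auto
  qed
  have "(\<lambda>n. \<Sum>l. ?a l n) \<longlonglongrightarrow> (\<Sum>l::nat. 0)"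
    using tannerys_theorem[OF lim bound summable_mult2[OF p] sequentially_bot] by blast
  then show ?thesis by simp
qed

theorem theorem2p14:
  fixes p :: "nat pmf"
    and w :: "nat \<Rightarrow> nat \<Rightarrow> real"
    and M :: "'a measure"
    and W :: "'a \<Rightarrow> real"
    and X :: "nat \<Rightarrow> 'a \<Rightarrow> nat"
    and \<epsilon> :: real
  assumes p_support: "set_pmf p \<subseteq> {2..}"
    and mu_finite: "summable (\<lambda>k. real k * pmf p k)"
    and mu2_finite: "summable (\<lambda>k. real k ^ 2 * pmf p k)"
    and w_nonneg: "\<And>n i. i \<in> {1..n} \<Longrightarrow> 0 \<le> w n i"
    and total_pos: "\<And>n. 1 \<le> n \<Longrightarrow> 0 < total_weight n (w n)"
    and M: "prob_space M"
    and W: "W \<in> borel_measurable M"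
    and W_conv: "weak_conv_m (\<lambda>n. distr (measure_pmf (pmf_of_set {1..n})) borel (w n)) (distr M borel W)"
    and W_integrable: "integrable M W"
    and W_mean_pos: "0 < (\<integral>\<omega>. W \<omega> \<partial>M)"
    and W_mean_conv: "(\<lambda>n. measure_pmf.expectation (pmf_of_set {1..n}) (w n))
                        \<longlonglongrightarrow> (\<integral>\<omega>. W \<omega> \<partial>M)"
    and W2_integrable: "integrable M (\<lambda>\<omega>. (W \<omega>)^2)"
    and W2_mean_conv: "(\<lambda>n. measure_pmf.expectation (pmf_of_set {1..n}) (\<lambda>i. (w n i)^2))
                        \<longlonglongrightarrow> (\<integral>\<omega>. (W \<omega>)^2 \<partial>M)"
    and X: "mixed_poisson_family M p W X"
    and eps: "0 < \<epsilon>"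
  shows "(\<lambda>n. measure_pmf.prob (group_pmf p n (w n))
            {\<omega>. (\<Sum>k. \<bar>degree_prop n \<omega> k - limit_prob M X k\<bar>) > \<epsilon>}) \<longlonglongrightarrow> 0"
proof -
  interpret prob_space M by (rule M)
  have ev: "\<forall>\<^sub>F n in sequentially. 1 \<le> n" by (rule eventually_ge_at_top)
  have average: "measure_pmf.expectation (pmf_of_set {1..n}) f = (\<Sum>i\<in>{1..n}. f i) / real n"
    if "1 \<le> n" for n and f :: "nat \<Rightarrow> real"
    using that by (subst integral_pmf_of_set) auto
  have weak: "(\<lambda>n. (\<Sum>i\<in>{1..n}. f (w n i)) / real n) \<longlonglongrightarrow> (\<integral>\<omega>. f (W \<omega>) \<partial>M)"
    if f: "\<And>x. isCont f x" "\<And>x. norm (f x) \<le> B" for f :: "real \<Rightarrow> real" and B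
  proof (rule Lim_transform_eventually)
    have f_meas: "f \<in> borel_measurable borel"
      using f by (intro borel_measurable_continuous_onI continuous_at_imp_continuous_on) auto
    have "(\<lambda>n. integral\<^sup>L (distr (measure_pmf (pmf_of_set {1..n})) borel (w n)) f)
        \<longlonglongrightarrow> integral\<^sup>L (distr M borel W) f"
      by (rule weak_conv_imp_integral_bdd_continuous_conv[OF _ _ W_conv f])
         (auto intro!: prob_space.real_distribution_distr measure_pmf.prob_space_axioms M W)
    then show "(\<lambda>n. measure_pmf.expectation (pmf_of_set {1..n}) (\<lambda>i. f (w n i))) \<longlonglongrightarrow> (\<integral>\<omega>. f (W \<omega>) \<partial>M)"
      using f_meas W by (simp add: integral_distr)
    show "\<forall>\<^sub>F n in sequentially. measure_pmf.expectation (pmf_of_set {1..n}) (\<lambda>i. f (w n i)) =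
        (\<Sum>i\<in>{1..n}. f (w n i)) / real n"
      using ev by eventually_elim (rule average)
  qed
  have W_nonneg: "AE \<omega> in M. 0 \<le> W \<omega>"
  proof -
    \<comment> \<open>A bounded continuous function that is positive exactly on the negative reals detects negative mass.\<close>
    let ?f = "\<lambda>x::real. min 1 (max 0 (- x))"
    have lim: "(\<lambda>n. (\<Sum>i\<in>{1..n}. ?f (w n i)) / real n) \<longlonglongrightarrow> (\<integral>\<omega>. ?f (W \<omega>) \<partial>M)"
      by (rule weak[of ?f 1]) (auto intro!: continuous_intros)
    have zero: "(\<Sum>i\<in>{1..n}. ?f (w n i)) / real n = 0" for n
      using w_nonneg[of _ n] by (simp add: sum.neutral)
    have "(\<integral>\<omega>. ?f (W \<omega>) \<partial>M) = 0"
      using lim unfolding zero by (rule LIMSEQ_unique) (rule tendsto_const)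
    moreover have "integrable M (\<lambda>\<omega>. ?f (W \<omega>))"
      using W by (intro integrable_const_bound[where B = 1]) auto
    ultimately have "AE \<omega> in M. ?f (W \<omega>) = 0"
      by (subst (asm) integral_nonneg_eq_0_iff_AE) auto
    then show ?thesis by eventually_elim (auto simp: min_def max_def split: if_splits)
  qed
  interpret mixed_poisson_limit M p W X
    by unfold_locales (use mu_finite mu2_finite W W_nonneg W_integrable X in auto)
  have groups: "inhomogeneous_groups p n (w n)" if "1 \<le> n" for n
    using p_support mu_finite w_nonneg total_pos that by unfold_locales auto
  define m where "m = (\<integral>\<omega>. W \<omega> \<partial>M)"
  have L_lim: "(\<lambda>n. total_weight n (w n) / real n) \<longlonglongrightarrow> m"
    unfolding m_def
    by (rule Lim_transform_eventually[OF W_mean_conv])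
       (use ev in eventually_elim, simp only: average total_weight_def)
  have S_lim: "(\<lambda>n. (\<Sum>i\<in>{1..n}. (w n i)\<^sup>2) / real n) \<longlonglongrightarrow> (\<integral>\<omega>. (W \<omega>)^2 \<partial>M)"
    by (rule Lim_transform_eventually[OF W2_mean_conv]) (use ev in eventually_elim, simp only: average)
  let ?q = "limit_prob M X"
  let ?E = "\<lambda>n. measure_pmf.expectation (group_pmf p n (w n))"
  define e where "e s n = ?E n (\<lambda>\<omega>. \<bar>(\<Sum>k. degree_prop n \<omega> k * s ^ k) - (\<Sum>k. ?q k * s ^ k)\<bar>)" for s n
  define d where "d k n = ?E n (\<lambda>\<omega>. \<bar>degree_prop n \<omega> k - ?q k\<bar>)" for k n
  have e_lim: "e s \<longlonglongrightarrow> 0" if s: "0 < s" "s < 1" for s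
  proof (rule tendsto_sandwich[OF _ _ tendsto_const])
    let ?g = "\<Sum>k. ?q k * s ^ k" and ?C = "\<Sum>k. real k ^ 2 * pmf p k" and ?c = "mark_exponent p s"
    let ?b = "\<lambda>n. sqrt (1 / real n + (total_weight n (w n) / real n) * ?C * (1 / real n)) +
      (\<Sum>l. (\<Sum>i\<in>{1..n}. odds_defect p n (w n) i l) / real n) +
      \<bar>(\<Sum>i\<in>{1..n}. exp (- (w n i * ?c))) / real n - ?g\<bar>"
    have s': "0 \<le> s" "s \<le> 1" using s by auto
    have c: "0 \<le> ?c" by (rule mark_exponent_nonneg[OF mu_finite s'])
    show "\<forall>\<^sub>F n in sequentially. 0 \<le> e s n"
      by (simp add: e_def)
    show "\<forall>\<^sub>F n in sequentially. e s n \<le> ?b n"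
      using ev by eventually_elim
        (use inhomogeneous_groups.degree_transform_deviation[OF groups _ s' mu2_finite] in \<open>simp add: e_def\<close>)
    \<comment> \<open>Weak convergence applies to bounded functions only, so the exponential is cut off on the negative
      reals, where neither the weights nor \<open>W\<close> have mass.\<close>
    have "(\<lambda>n. (\<Sum>i\<in>{1..n}. exp (- (max 0 (w n i) * ?c))) / real n) \<longlonglongrightarrow> (\<integral>\<omega>. exp (- (max 0 (W \<omega>) * ?c)) \<partial>M)"
      using c by (intro weak[of "\<lambda>x. exp (- (max 0 x * ?c))" 1]) (auto intro!: continuous_intros)
    also have "(\<lambda>n. (\<Sum>i\<in>{1..n}. exp (- (max 0 (w n i) * ?c))) / real n) =
        (\<lambda>n. (\<Sum>i\<in>{1..n}. exp (- (w n i * ?c))) / real n)"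
      using w_nonneg by (intro ext arg_cong2[where f = "(/)"] sum.cong refl) (simp add: max_def)
    also have "(\<integral>\<omega>. exp (- (max 0 (W \<omega>) * ?c)) \<partial>M) = (\<integral>\<omega>. exp (- (W \<omega> * ?c)) \<partial>M)"
      using W by (intro integral_cong_AE) (use W_nonneg in \<open>auto simp: max_def\<close>)
    also have "\<dots> = ?g"
      using limit_transform[OF s'(1) s(2)] by simp
    finally have mean: "(\<lambda>n. (\<Sum>i\<in>{1..n}. exp (- (w n i * ?c))) / real n) \<longlonglongrightarrow> ?g" .
    have "?b \<longlonglongrightarrow> sqrt (0 + m * ?C * 0) + 0 + \<bar>?g - ?g\<bar>"
      using W_mean_pos
      by (intro tendsto_intros lim_1_over_n L_lim mean mean_odds_defect_tendsto[OF groups _ L_lim S_lim])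
         (auto simp: m_def)
    then show "?b \<longlonglongrightarrow> 0" by simp
  qed
  have d_lim: "d k \<longlonglongrightarrow> 0" for k
  proof (rule coefficient_errors_vanish[OF _ e_lim])
    show "0 \<le> d k n" for k n by (simp add: d_def)
    fix k and s :: real assume s: "0 < s" "s < 1"
    show "\<forall>\<^sub>F n in sequentially. d k n \<le> (e s n + (\<Sum>j<k. d j n)) / s ^ k + s"
      using ev
    proof eventually_elim
      case (elim n)
      have "d k n \<le> ?E n (\<lambda>\<omega>. (\<bar>(\<Sum>k. degree_prop n \<omega> k * s ^ k) - (\<Sum>k. ?q k * s ^ k)\<bar> +
          (\<Sum>j<k. \<bar>degree_prop n \<omega> j - ?q j\<bar>)) / s ^ k + s)"
        unfolding d_def
        by (intro integral_mono coefficient_diff_le degree_prop_nonneg degree_prop_sums elim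
            limit_prob_nonneg limit_prob_sums s) auto
      then show ?case
        by (simp add: d_def e_def)
    qed
  qed
  let ?Z = "\<lambda>n \<omega>. \<Sum>k. \<bar>degree_prop n \<omega> k - ?q k\<bar>"
  have Z_le: "?E n (?Z n) \<le> 2 * (\<Sum>k<K. d k n) + 2 * (\<Sum>k. ?q (k + K))" if n: "1 \<le> n" for n K
  proof -
    have "?E n (?Z n) \<le> ?E n (\<lambda>\<omega>. 2 * (\<Sum>k<K. \<bar>degree_prop n \<omega> k - ?q k\<bar>) + 2 * (\<Sum>k. ?q (k + K)))"
      by (intro integral_mono l1_distance_le degree_prop_nonneg degree_prop_sums n
          limit_prob_nonneg limit_prob_sums) auto
    then show ?thesis by (simp add: d_def)
  qed
  have Z_nonneg: "0 \<le> ?Z n \<omega>" if "1 \<le> n" for n \<omega>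
  proof (intro suminf_nonneg)
    have "summable (\<lambda>k. degree_prop n \<omega> k + ?q k)"
      by (intro summable_add summable_limit_prob sums_summable[OF degree_prop_sums[OF that]])
    then show "summable (\<lambda>k. \<bar>degree_prop n \<omega> k - ?q k\<bar>)"
    proof (rule summable_comparison_test'[where N = 0])
      fix k
      show "norm \<bar>degree_prop n \<omega> k - ?q k\<bar> \<le> degree_prop n \<omega> k + ?q k"
        using degree_prop_nonneg[of n \<omega> k] limit_prob_nonneg[of k] by simp
    qed
  qed simp
  have Z_lim: "(\<lambda>n. ?E n (?Z n)) \<longlonglongrightarrow> 0"
  proof (rule tendstoI)
    fix \<delta> :: real assume \<delta>: "0 < \<delta>"
    obtain K where "norm (\<Sum>k. ?q (k + K)) < \<delta> / 2"
      using suminf_exist_split[OF _ summable_limit_prob, of "\<delta> / 2"] \<delta> by auto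
    then have K: "2 * (\<Sum>k. ?q (k + K)) < \<delta>" by simp
    have "(\<lambda>n. 2 * (\<Sum>k<K. d k n) + 2 * (\<Sum>k. ?q (k + K))) \<longlonglongrightarrow> 2 * (\<Sum>k<K. 0) + 2 * (\<Sum>k. ?q (k + K))"
      by (intro tendsto_intros d_lim)
    then have "\<forall>\<^sub>F n in sequentially. 2 * (\<Sum>k<K. d k n) + 2 * (\<Sum>k. ?q (k + K)) < \<delta>"
      using K by (intro order_tendstoD) auto
    with ev show "\<forall>\<^sub>F n in sequentially. dist (?E n (?Z n)) 0 < \<delta>"
    proof eventually_elim
      case (elim n)
      have "0 \<le> ?E n (?Z n)"
        using Z_nonneg[OF elim(1)] by (intro integral_nonneg_AE) auto
      then show ?case
        using Z_le[OF elim(1), of K] elim(2) by simp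
    qed
  qed
  show ?thesis
  proof (rule tendsto_sandwich[OF _ _ tendsto_const])
    show "\<forall>\<^sub>F n in sequentially. measure_pmf.prob (group_pmf p n (w n)) {\<omega>. ?Z n \<omega> > \<epsilon>} \<le> ?E n (?Z n) / \<epsilon>"
      using ev
    proof eventually_elim
      case (elim n)
      have "measure_pmf.prob (group_pmf p n (w n)) {\<omega>. ?Z n \<omega> > \<epsilon>} \<le>
          measure_pmf.prob (group_pmf p n (w n)) {\<omega> \<in> space (measure_pmf (group_pmf p n (w n))). ?Z n \<omega> \<ge> \<epsilon>}"
        by (intro measure_pmf.finite_measure_mono) auto
      also have "\<dots> \<le> ?E n (?Z n) / \<epsilon>"
        using Z_nonneg[OF elim] eps by (intro integral_Markov_inequality_measure[where A = UNIV]) auto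
      finally show ?case .
    qed
    show "(\<lambda>n. ?E n (?Z n) / \<epsilon>) \<longlonglongrightarrow> 0"
      using tendsto_divide[OF Z_lim tendsto_const, of \<epsilon>] eps by simp
  qed simp
qed

end
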